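(* For $d\in\mathbb N$ let $\rho_d\in\mathbb R\cup\{+\infty\}$ be the value of the semidefinite program $$\rho_d=\inf\int_{\mathcal Q}v_d(q)\,dq$$ over $v_d\in\mathbb R[q]_{2d}$, $\sigma_0\in\Sigma[q,x,y]_{2d}$, $\sigma_j\in\Sigma[q,x,y]_{2d-2}$ ($j=1,\dots,n$), $\tau_\Re,\tau_\Im\in\mathbb R[q,x,y]_{2d-m}$ subject to the polynomial identity in $\mathbb R[q,x,y]$ $$v_d(q)-x=\sigma_0+\sum_{j=1}^n\sigma_j\,(1-q_j^2)+\tau_\Re\,p_\Re+\tau_\Im\,p_\Im .$$ Let $d_0$ be such that this program is feasible for all $d\ge d_0$, and for each $d\ge d_0$ let $v_d$ be a near optimal solution, i.e. a feasible $v_d$ with $\int_{\mathcal Q}v_d(q)\,dq\le\rho_d+\frac1d$. Then $v_d\ge a$ on $\mathcal Q$ and $v_d$ converges to the abscissa $a$ in $L^1(\mathcal Q)$ norm, i.e. $\lim_{d\to\infty}\int_{\mathcal Q}|v_d(q)-a(q)|\,dq=0$. Moreover $\lim_{d\to\infty}\rho_d=\int_{\mathcal Q}a(q)\,dq$.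
   Context: Let $n\ge1$, $\mathcal Q=[-1,1]^n$, $dq$ Lebesgue measure. Let $m\ge1$ and $p(q,s)=\sum_{k=0}^m p_k(q)s^k$ with $p_k\in\mathbb R[q]$ and $p_m\equiv1$, $s\in\mathbb C$. The abscissa is $a(q)=\max\{\Re(s): p(q,s)=0\}$, $q\in\mathcal Q$. Writing $s=x+iy$, define $p_\Re,p_\Im\in\mathbb R[q,x,y]$ by $p(q,x+iy)=p_\Re(q,x,y)+i\,p_\Im(q,x,y)$. $\mathbb R[z]_k$ denotes real polynomials in the variables $z$ of degree at most $k$, and $\Sigma[z]_{2k}$ the sums of squares of polynomials in $z$ of degree at most $2k$. *)

theory Defs
  imports "HOL-Analysis.Analysis" "HOL-Library.Extended_Real"
begin

definition cubeQ :: "(real^'n) set" where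
  "cubeQ = cbox (\<chi> i. -1) (\<chi> i. 1)"

text \<open>Polynomial functions in q of total degree at most k (k an integer; for k < 0
  only the zero polynomial). Monomials are indexed by exponent vectors.\<close>

definition mono_q :: "('n::finite \<Rightarrow> nat) \<Rightarrow> real^'n \<Rightarrow> real" where
  "mono_q \<alpha> q = (\<Prod>i\<in>UNIV. (q $ i) ^ (\<alpha> i))"

definition poly_q :: "int \<Rightarrow> (real^'n::finite \<Rightarrow> real) \<Rightarrow> bool" where
  "poly_q k f \<longleftrightarrow> (\<exists>c :: ('n \<Rightarrow> nat) \<Rightarrow> real.
      finite {e. c e \<noteq> 0} \<and> (\<forall>e. c e \<noteq> 0 \<longrightarrow> int (sum e UNIV) \<le> k) \<and>
      (\<forall>q. f q = (\<Sum>e\<in>{e. c e \<noteq> 0}. c e * mono_q e q)))"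

definition mono_qxy :: "('n::finite \<Rightarrow> nat) \<times> nat \<times> nat \<Rightarrow> real^'n \<Rightarrow> real \<Rightarrow> real \<Rightarrow> real" where
  "mono_qxy e q x y = mono_q (fst e) q * x ^ fst (snd e) * y ^ snd (snd e)"

definition deg_qxy :: "('n::finite \<Rightarrow> nat) \<times> nat \<times> nat \<Rightarrow> nat" where
  "deg_qxy e = sum (fst e) UNIV + fst (snd e) + snd (snd e)"

definition poly_qxy :: "int \<Rightarrow> (real^'n::finite \<Rightarrow> real \<Rightarrow> real \<Rightarrow> real) \<Rightarrow> bool" where
  "poly_qxy k f \<longleftrightarrow> (\<exists>c :: ('n \<Rightarrow> nat) \<times> nat \<times> nat \<Rightarrow> real.
      finite {e. c e \<noteq> 0} \<and> (\<forall>e. c e \<noteq> 0 \<longrightarrow> int (deg_qxy e) \<le> k) \<and>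
      (\<forall>q x y. f q x y = (\<Sum>e\<in>{e. c e \<noteq> 0}. c e * mono_qxy e q x y)))"

definition sos_qxy :: "int \<Rightarrow> (real^'n::finite \<Rightarrow> real \<Rightarrow> real \<Rightarrow> real) \<Rightarrow> bool" where
  "sos_qxy D f \<longleftrightarrow> (\<exists>gs. (\<forall>g\<in>set gs. poly_qxy (D div 2) g) \<and>
      (\<forall>q x y. f q x y = (\<Sum>g\<leftarrow>gs. (g q x y)\<^sup>2)))"

definition pc :: "(nat \<Rightarrow> real^'n \<Rightarrow> real) \<Rightarrow> nat \<Rightarrow> real^'n \<Rightarrow> complex \<Rightarrow> complex" where
  "pc pk m q s = (\<Sum>k\<le>m. complex_of_real (pk k q) * s ^ k)"

definition pRe :: "(nat \<Rightarrow> real^'n \<Rightarrow> real) \<Rightarrow> nat \<Rightarrow> real^'n \<Rightarrow> real \<Rightarrow> real \<Rightarrow> real" where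
  "pRe pk m q x y = Re (pc pk m q (Complex x y))"

definition pIm :: "(nat \<Rightarrow> real^'n \<Rightarrow> real) \<Rightarrow> nat \<Rightarrow> real^'n \<Rightarrow> real \<Rightarrow> real \<Rightarrow> real" where
  "pIm pk m q x y = Im (pc pk m q (Complex x y))"

definition abscissa :: "(nat \<Rightarrow> real^'n \<Rightarrow> real) \<Rightarrow> nat \<Rightarrow> real^'n \<Rightarrow> real" where
  "abscissa pk m q = Max (Re ` {s. pc pk m q s = 0})"

definition feasible :: "(nat \<Rightarrow> real^'n::finite \<Rightarrow> real) \<Rightarrow> nat \<Rightarrow> nat \<Rightarrow> (real^'n \<Rightarrow> real) \<Rightarrow> bool" where
  "feasible pk m d v \<longleftrightarrow> poly_q (2 * int d) v \<and>
     (\<exists>\<sigma>0 (\<sigma> :: 'n \<Rightarrow> real^'n \<Rightarrow> real \<Rightarrow> real \<Rightarrow> real) \<tau>R \<tau>I.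
        sos_qxy (2 * int d) \<sigma>0 \<and> (\<forall>j. sos_qxy (2 * int d - 2) (\<sigma> j)) \<and>
        poly_qxy (2 * int d - int m) \<tau>R \<and> poly_qxy (2 * int d - int m) \<tau>I \<and>
        (\<forall>q x y. v q - x = \<sigma>0 q x y + (\<Sum>j\<in>UNIV. \<sigma> j q x y * (1 - (q $ j)\<^sup>2))
                    + \<tau>R q x y * pRe pk m q x y + \<tau>I q x y * pIm pk m q x y))"

definition rho :: "(nat \<Rightarrow> real^'n::finite \<Rightarrow> real) \<Rightarrow> nat \<Rightarrow> nat \<Rightarrow> ereal" where
  "rho pk m d = Inf {ereal (integral cubeQ v) | v. feasible pk m d v}"

end

theory Submission
  imports Defs "HOL-Computational_Algebra.Fundamental_Theorem_Algebra"
begin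

text \<open>
  A feasible v dominates the abscissa on the cube, because the right-hand side of the identity is
  nonnegative at every root. For the converse, roots depend continuously on the coefficients (for
  every s there is a root r of the monic polynomial with |s - r|^m at most |p(q,s)|), so the
  Stone--Weierstrass theorem gives polynomials g slightly above the abscissa. Then g(q) - x is
  positive on the compact set cut out by the constraints, and Putinar's Positivstellensatz shows
  that g is feasible for all large d.

  The Positivstellensatz is proved algebraically. If M is an Archimedean quadratic module not
  containing -1, a maximal proper quadratic module above M is a total order up to its support, and
  comparison with the constants is evaluation at a point where M is nonnegative. Applied to M
  enlarged by -f, for f positive wherever M is nonnegative, this yields a sum of squares s with
  sf - 1 in M, and then f + r in M implies f + r - c in M for a fixed c > 0.

  M is Archimedean because |s|^(2m) is bounded, modulo the ideal of the roots, by a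
  combination of lower powers of |s|^2 with constant coefficients.
\<close>

section \<open>Polynomial functions built from coordinates\<close>

lemmas real_polynomial_intros = real_polynomial_function.intros(2-4) real_polynomial_function_minus real_polynomial_function_diff
  real_polynomial_function_power

text \<open>The built-in induction starts from all bounded linear functionals. Expanding such a
  functional in the standard basis leaves only coordinates and constants as base cases, which is the
  form needed for point evaluation and for monomial expansions.\<close>

lemma real_polynomial_function_coordinate_induct [consumes 1, case_names coordinate const add mult]:
  fixes p :: "'a::euclidean_space \<Rightarrow> real"
  assumes "real_polynomial_function p"
    and coordinate: "\<And>b. b \<in> Basis \<Longrightarrow> P (\<lambda>z. z \<bullet> b)"
    and const: "\<And>c. P (\<lambda>_. c)"
    and add: "\<And>f g. P f \<Longrightarrow> P g \<Longrightarrow> P (\<lambda>z. f z + g z)"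
    and mult: "\<And>f g. P f \<Longrightarrow> P g \<Longrightarrow> P (\<lambda>z. f z * g z)"
  shows "P p"
  using assms(1)
proof (induction rule: real_polynomial_function.induct)
  case (linear f)
  have sums: "P (\<lambda>z. \<Sum>b\<in>B. (z \<bullet> b) * f b)" if "finite B" "B \<subseteq> Basis" for B
    using that
  proof (induction rule: finite_induct)
    case empty
    then show ?case using const by simp
  next
    case (insert b B)
    have "P (\<lambda>z. (z \<bullet> b) * f b + (\<Sum>b\<in>B. (z \<bullet> b) * f b))"
      using insert by (intro add mult coordinate const) auto
    then show ?case using insert by simp
  qed
  have "f z = (\<Sum>b\<in>Basis. (z \<bullet> b) * f b)" for z
  proof -
    have "f z = f (\<Sum>b\<in>Basis. (z \<bullet> b) *\<^sub>R b)" by (simp add: euclidean_representation)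
    also have "\<dots> = (\<Sum>b\<in>Basis. (z \<bullet> b) * f b)"
      using linear.hyps bounded_linear.linear[of f]
      by (simp add: linear_sum linear_scale)
    finally show ?thesis .
  qed
  then have "f = (\<lambda>z. \<Sum>b\<in>Basis. (z \<bullet> b) * f b)" by blast
  then show ?case using sums[of Basis] by (metis finite_Basis order_refl)
qed (use const add mult in auto)

section \<open>Quadratic modules\<close>

locale quadratic_module =
  fixes M :: "('a::euclidean_space \<Rightarrow> real) set"
  assumes real_polynomial: "f \<in> M \<Longrightarrow> real_polynomial_function f"
    and one_mem: "(\<lambda>_. 1) \<in> M"
    and add_mem: "f \<in> M \<Longrightarrow> g \<in> M \<Longrightarrow> (\<lambda>z. f z + g z) \<in> M"
    and square_mult_mem: "real_polynomial_function h \<Longrightarrow> f \<in> M \<Longrightarrow> (\<lambda>z. (h z)\<^sup>2 * f z) \<in> M"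
begin

text \<open>Separates membership from algebra: an expression built by the closure rules is placed in
  M, and a pointwise identity then transfers membership to the intended form.\<close>

lemma cong_mem: "f \<in> M \<Longrightarrow> (\<And>z. g z = f z) \<Longrightarrow> g \<in> M"
  by (metis ext)

lemma square_mem: "real_polynomial_function h \<Longrightarrow> (\<lambda>z. (h z)\<^sup>2) \<in> M"
  using square_mult_mem[OF _ one_mem] by simp

lemma scale_mem:
  assumes "0 \<le> c" "f \<in> M" shows "(\<lambda>z. c * f z) \<in> M"
  by (rule cong_mem[OF square_mult_mem[OF real_polynomial_function.intros(2)[of "sqrt c"] assms(2)]])
     (simp add: assms)

lemma const_mem: "0 \<le> c \<Longrightarrow> (\<lambda>_. c) \<in> M"
  using scale_mem[OF _ one_mem, of c] by simp

lemma add_const_mem: "0 \<le> c \<Longrightarrow> f \<in> M \<Longrightarrow> (\<lambda>z. f z + c) \<in> M"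
  using add_mem const_mem by blast

lemma sum_mem:
  assumes "finite I" "\<And>i. i \<in> I \<Longrightarrow> f i \<in> M"
  shows "(\<lambda>z. \<Sum>i\<in>I. f i z) \<in> M"
  using assms
proof (induction rule: finite_induct)
  case empty
  then show ?case using const_mem[of 0] by simp
next
  case (insert i I)
  then have "(\<lambda>z. f i z + (\<Sum>i\<in>I. f i z)) \<in> M" by (intro add_mem) auto
  then show ?case using insert by simp
qed

lemma negative_const_mem:
  assumes "(\<lambda>_. c) \<in> M" "c < 0" shows "(\<lambda>_. - 1) \<in> M"
  by (rule cong_mem[OF scale_mem[OF _ assms(1), of "inverse (- c)"]])
     (use assms in \<open>auto simp: field_simps\<close>)

text \<open>Products of members need not be members, so N^2 - f^2 cannot be had by multiplying the
  two assumptions. Instead 2N(N^2 - f^2) = (N + f)^2 (N - f) + (N - f)^2 (N + f) is a combination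
  with square weights.\<close>

lemma square_bound:
  assumes N: "0 < N" and minus: "(\<lambda>z. N - f z) \<in> M" and plus: "(\<lambda>z. N + f z) \<in> M"
  shows "(\<lambda>z. N\<^sup>2 - (f z)\<^sup>2) \<in> M"
proof -
  have "(\<lambda>z. inverse (2 * N) * ((N + f z)\<^sup>2 * (N - f z) + (N - f z)\<^sup>2 * (N + f z))) \<in> M"
    using assms by (intro scale_mem add_mem[OF square_mult_mem[OF _ minus] square_mult_mem[OF _ plus]] real_polynomial) auto
  moreover have "N\<^sup>2 - (f z)\<^sup>2 = inverse (2 * N) * ((N + f z)\<^sup>2 * (N - f z) + (N - f z)\<^sup>2 * (N + f z))" for z
  proof -
    have "(N + f z)\<^sup>2 * (N - f z) + (N - f z)\<^sup>2 * (N + f z) = 2 * N * (N\<^sup>2 - (f z)\<^sup>2)" by algebra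
    then show ?thesis using N by simp
  qed
  ultimately show ?thesis by (rule cong_mem)
qed

text \<open>M is Archimedean when every polynomial is bounded in this sense. The bounded elements
  form a ring, so it suffices to bound the coordinates.\<close>

definition bounded_elem :: "('a \<Rightarrow> real) \<Rightarrow> bool" where
  "bounded_elem f \<longleftrightarrow> (\<exists>N>0. (\<lambda>z. N - f z) \<in> M \<and> (\<lambda>z. N + f z) \<in> M)"

lemma bounded_elem_polynomial:
  assumes "bounded_elem f" shows "real_polynomial_function f"
proof -
  obtain N where "(\<lambda>z. N + f z) \<in> M" using assms bounded_elem_def by blast
  then have "real_polynomial_function (\<lambda>z. (N + f z) - N)"
    by (intro real_polynomial_intros real_polynomial)
  then show ?thesis by simp
qed

lemma bounded_elem_const: "bounded_elem (\<lambda>_. c)"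
  unfolding bounded_elem_def
  by (rule exI[of _ "\<bar>c\<bar> + 1"]) (auto intro!: const_mem)

lemma bounded_elem_add:
  assumes "bounded_elem f" "bounded_elem g" shows "bounded_elem (\<lambda>z. f z + g z)"
proof -
  obtain A B where A: "A > 0" "(\<lambda>z. A - f z) \<in> M" "(\<lambda>z. A + f z) \<in> M"
    and B: "B > 0" "(\<lambda>z. B - g z) \<in> M" "(\<lambda>z. B + g z) \<in> M"
    using assms bounded_elem_def by auto
  have "(\<lambda>z. (A + B) - (f z + g z)) \<in> M"
    by (rule cong_mem[OF add_mem[OF A(2) B(2)]]) simp
  moreover have "(\<lambda>z. (A + B) + (f z + g z)) \<in> M"
    by (rule cong_mem[OF add_mem[OF A(3) B(3)]]) simp
  ultimately show ?thesis unfolding bounded_elem_def using A B by (intro exI[of _ "A + B"]) auto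
qed

lemma bounded_elem_minus:
  assumes "bounded_elem f" shows "bounded_elem (\<lambda>z. - f z)"
  using assms unfolding bounded_elem_def by auto

lemma bounded_elem_scale:
  assumes "bounded_elem f" "c > 0" shows "bounded_elem (\<lambda>z. c * f z)"
proof -
  obtain A where A: "A > 0" "(\<lambda>z. A - f z) \<in> M" "(\<lambda>z. A + f z) \<in> M"
    using assms bounded_elem_def by auto
  have "(\<lambda>z. c * A - c * f z) \<in> M"
    by (rule cong_mem[OF scale_mem[OF _ A(2), of c]]) (use assms in \<open>auto simp: algebra_simps\<close>)
  moreover have "(\<lambda>z. c * A + c * f z) \<in> M"
    by (rule cong_mem[OF scale_mem[OF _ A(3), of c]]) (use assms in \<open>auto simp: algebra_simps\<close>)
  ultimately show ?thesis
    unfolding bounded_elem_def using A assms by (intro exI[of _ "c * A"]) auto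
qed

lemma bounded_elem_square:
  assumes "bounded_elem f" shows "bounded_elem (\<lambda>z. (f z)\<^sup>2)"
proof -
  obtain A where A: "A > 0" "(\<lambda>z. A - f z) \<in> M" "(\<lambda>z. A + f z) \<in> M"
    using assms bounded_elem_def by auto
  have "(\<lambda>z. A\<^sup>2 - (f z)\<^sup>2) \<in> M" using square_bound A by blast
  moreover have "(\<lambda>z. A\<^sup>2 + (f z)\<^sup>2) \<in> M"
    by (intro add_mem const_mem square_mem bounded_elem_polynomial assms) auto
  ultimately show ?thesis unfolding bounded_elem_def using A by (intro exI[of _ "A\<^sup>2"]) auto
qed

text \<open>Polarization, 4fg = (f + g)^2 - (f - g)^2, reduces products to squares.\<close>

lemma bounded_elem_mult:
  assumes "bounded_elem f" "bounded_elem g" shows "bounded_elem (\<lambda>z. f z * g z)"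
proof -
  have "bounded_elem (\<lambda>z. 1/4 * ((f z + g z)\<^sup>2 + - (f z + - g z)\<^sup>2))"
    by (intro bounded_elem_scale bounded_elem_add bounded_elem_square bounded_elem_minus assms) auto
  moreover have "1/4 * ((f z + g z)\<^sup>2 + - (f z + - g z)\<^sup>2) = f z * g z" for z
    by (simp add: power2_eq_square algebra_simps)
  ultimately show ?thesis by simp
qed

text \<open>From (f - 1)^2 and (f + 1)^2 one gets that 2f and -2f are at most f^2 + 1. The extra |N|
  + 1 makes the resulting bound positive for every sign of N.\<close>

lemma bounded_elem_if_square_le:
  assumes f: "real_polynomial_function f" and N: "(\<lambda>z. N - (f z)\<^sup>2) \<in> M"
  shows "bounded_elem f"
proof -
  have "(\<lambda>z. 1/2 * ((N - (f z)\<^sup>2) + (f z - 1)\<^sup>2 + \<bar>N\<bar> + 1)) \<in> M"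
       "(\<lambda>z. 1/2 * ((N - (f z)\<^sup>2) + (f z + 1)\<^sup>2 + \<bar>N\<bar> + 1)) \<in> M"
    by (intro scale_mem add_mem N square_mem const_mem real_polynomial_intros f; simp)+
  then have "(\<lambda>z. (N + \<bar>N\<bar> + 2) / 2 - f z) \<in> M" "(\<lambda>z. (N + \<bar>N\<bar> + 2) / 2 + f z) \<in> M"
    by - (erule cong_mem, simp add: power2_eq_square field_simps)+
  moreover have "(N + \<bar>N\<bar> + 2) / 2 > 0" by simp
  ultimately show ?thesis
    unfolding bounded_elem_def by blast
qed

lemma bounded_elem_compose:
  fixes h :: "'a \<Rightarrow> 'b::euclidean_space"
  assumes p: "real_polynomial_function p" and h: "\<And>b. b \<in> Basis \<Longrightarrow> bounded_elem (\<lambda>z. h z \<bullet> b)"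
  shows "bounded_elem (\<lambda>z. p (h z))"
  using p
  by (induction rule: real_polynomial_function_coordinate_induct)
     (auto intro: h bounded_elem_const bounded_elem_add bounded_elem_mult)

end

section \<open>Generated quadratic modules and extension by one element\<close>

inductive_set generated_module :: "('a::euclidean_space \<Rightarrow> real) set \<Rightarrow> ('a \<Rightarrow> real) set"
  for G where
  square: "real_polynomial_function h \<Longrightarrow> (\<lambda>z. (h z)\<^sup>2) \<in> generated_module G"
| generator: "g \<in> G \<Longrightarrow> real_polynomial_function h \<Longrightarrow> (\<lambda>z. (h z)\<^sup>2 * g z) \<in> generated_module G"
| add: "f \<in> generated_module G \<Longrightarrow> g \<in> generated_module G \<Longrightarrow> (\<lambda>z. f z + g z) \<in> generated_module G"

abbreviation sums_of_squares :: "('a::euclidean_space \<Rightarrow> real) set" where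
  "sums_of_squares \<equiv> generated_module {}"

lemma quadratic_module_generated:
  assumes G: "\<And>g. g \<in> G \<Longrightarrow> real_polynomial_function g"
  shows "quadratic_module (generated_module G)"
proof
  show "real_polynomial_function f" if "f \<in> generated_module G" for f
    using that by induction (simp_all add: real_polynomial_intros G)
  show "(\<lambda>_. 1) \<in> generated_module G"
    using generated_module.square[OF real_polynomial_function.intros(2)[of 1]] by simp
  show "(\<lambda>z. (h z)\<^sup>2 * f z) \<in> generated_module G"
    if h: "real_polynomial_function h" and f: "f \<in> generated_module G" for h f
    using f
  proof induction
    case (square k)
    have "(\<lambda>z. (h z * k z)\<^sup>2) \<in> generated_module G"
      by (intro generated_module.square real_polynomial_intros h square)
    then show ?case by (simp add: power_mult_distrib)
  next
    case (generator g k)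
    have "(\<lambda>z. (h z * k z)\<^sup>2 * g z) \<in> generated_module G"
      by (intro generated_module.generator real_polynomial_intros h generator)
    then show ?case by (simp add: power_mult_distrib mult.assoc)
  next
    case (add f g)
    then show ?case using generated_module.add[OF add.IH] by (simp add: algebra_simps)
  qed
qed (rule generated_module.add)

interpretation sos: quadratic_module sums_of_squares
  by (rule quadratic_module_generated) auto

context quadratic_module
begin

lemma sos_mult_mem:
  assumes "s \<in> sums_of_squares" "f \<in> M" shows "(\<lambda>z. s z * f z) \<in> M"
  using assms(1)
proof induction
  case (square h)
  then show ?case using square_mult_mem assms by blast
next
  case (add s t)
  then show ?case using add_mem[OF add.IH] by (simp add: algebra_simps)
qed auto

lemma sos_mem: "s \<in> sums_of_squares \<Longrightarrow> s \<in> M"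
  using sos_mult_mem[OF _ one_mem] by simp

text \<open>For polynomial a this is the least quadratic module containing M and a.\<close>

definition extension :: "('a \<Rightarrow> real) \<Rightarrow> ('a \<Rightarrow> real) set" where
  "extension a = {\<lambda>z. g z + s z * a z | g s. g \<in> M \<and> s \<in> sums_of_squares}"

lemma extensionI:
  "g \<in> M \<Longrightarrow> s \<in> sums_of_squares \<Longrightarrow> (\<And>z. f z = g z + s z * a z) \<Longrightarrow> f \<in> extension a"
  unfolding extension_def by blast

lemma extension_subset: "M \<subseteq> extension a"
  using extensionI[OF _ sos.const_mem[of 0]] by auto

lemma extension_mem: "a \<in> extension a"
  using extensionI[OF const_mem[of 0] sos.one_mem] by auto

lemma quadratic_module_extend:
  assumes a: "real_polynomial_function a"
  shows "quadratic_module (extension a)"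
proof
  show "real_polynomial_function f" if fE: "f \<in> extension a" for f
  proof -
    obtain f1 s where f: "f = (\<lambda>z. f1 z + s z * a z)" "f1 \<in> M" "s \<in> sums_of_squares"
      using fE unfolding extension_def by auto
    show ?thesis
      unfolding f(1)
      by (intro real_polynomial_intros real_polynomial[OF f(2)] sos.real_polynomial[OF f(3)] a)
  qed
  show "(\<lambda>_. 1) \<in> extension a"
    using one_mem extension_subset by blast
  show "(\<lambda>z. f z + g z) \<in> extension a" if fgE: "f \<in> extension a" "g \<in> extension a" for f g
  proof -
    obtain f1 s g1 t where f: "f = (\<lambda>z. f1 z + s z * a z)" "f1 \<in> M" "s \<in> sums_of_squares"
      and g: "g = (\<lambda>z. g1 z + t z * a z)" "g1 \<in> M" "t \<in> sums_of_squares"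
      using fgE unfolding extension_def by auto
    show ?thesis
      by (rule extensionI[OF add_mem[OF f(2) g(2)] sos.add_mem[OF f(3) g(3)]])
         (simp add: f g algebra_simps)
  qed
  show "(\<lambda>z. (h z)\<^sup>2 * f z) \<in> extension a" if h: "real_polynomial_function h" and fE: "f \<in> extension a" for h f
  proof -
    obtain f1 s where f: "f = (\<lambda>z. f1 z + s z * a z)" "f1 \<in> M" "s \<in> sums_of_squares"
      using fE unfolding extension_def by auto
    show ?thesis
      by (rule extensionI[OF square_mult_mem[OF h f(2)] sos.square_mult_mem[OF h f(3)]])
         (simp add: f algebra_simps)
  qed
qed

text \<open>The support, where both f and -f belong to M, is an ideal: h is the difference of the
  squares of (h + 1)/2 and (h - 1)/2, and the second square is applied to -f.\<close>

lemma support_mult: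
  assumes f: "f \<in> M" "(\<lambda>z. - f z) \<in> M" and h: "real_polynomial_function h"
  shows "(\<lambda>z. h z * f z) \<in> M"
proof -
  have "(\<lambda>z. ((h z + 1) * (1/2))\<^sup>2 * f z + ((h z - 1) * (1/2))\<^sup>2 * (- f z)) \<in> M"
    by (intro add_mem square_mult_mem real_polynomial_intros h f)
  moreover have "h z * f z = ((h z + 1) * (1/2))\<^sup>2 * f z + ((h z - 1) * (1/2))\<^sup>2 * (- f z)" for z
    by (simp add: power2_eq_square field_simps)
  ultimately show ?thesis by (rule cong_mem)
qed

end

section \<open>Maximal quadratic modules and point evaluation\<close>

locale maximal_quadratic_module = quadratic_module +
  assumes proper: "(\<lambda>_. - 1) \<notin> M"
    and maximal: "\<And>S. quadratic_module S \<Longrightarrow> M \<subseteq> S \<Longrightarrow> (\<lambda>_. - 1) \<notin> S \<Longrightarrow> S = M"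
    and archimedean: "\<And>f. real_polynomial_function f \<Longrightarrow> bounded_elem f"
begin

lemma not_mem_witness:
  assumes a: "real_polynomial_function a" and "a \<notin> M"
  obtains g s where "g \<in> M" "s \<in> sums_of_squares" "\<And>z. - 1 = g z + s z * a z"
proof -
  have "(\<lambda>_. - 1) \<in> extension a"
    using maximal[OF quadratic_module_extend[OF a] extension_subset] extension_mem \<open>a \<notin> M\<close> by blast
  then obtain g s where "g \<in> M" "s \<in> sums_of_squares" "(\<lambda>_. - 1) = (\<lambda>z. g z + s z * a z)"
    unfolding extension_def by blast
  then show ?thesis using that[of g s] by meson
qed

text \<open>If both signs fail, maximality gives -1 = g + s a and -1 = h - t a. Eliminating a yields
  -s = t g + s h + t in M, so s lies in the support. Then s a is in M as well, and the first
  equation puts -1 in M.\<close>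

lemma total:
  assumes a: "real_polynomial_function a"
  shows "a \<in> M \<or> (\<lambda>z. - a z) \<in> M"
proof (rule ccontr)
  assume "\<not> ?thesis"
  then obtain g s h t where g: "g \<in> M" "s \<in> sums_of_squares" "\<And>z. - 1 = g z + s z * a z"
    and h: "h \<in> M" "t \<in> sums_of_squares" "\<And>z. - 1 = h z + t z * - a z"
    using not_mem_witness[OF a] not_mem_witness[OF real_polynomial_function_minus[OF a]] by metis
  have "(\<lambda>z. t z * g z + s z * h z + t z) \<in> M"
    by (intro add_mem sos_mult_mem g h sos_mem)
  moreover have "- s z = t z * g z + s z * h z + t z" for z
    using g(3)[of z] h(3)[of z] by algebra
  ultimately have "(\<lambda>z. - s z) \<in> M" by (rule cong_mem)
  then have "(\<lambda>z. a z * s z) \<in> M" using support_mult sos_mem g(2) a by blast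
  from add_mem[OF g(1) this] have "(\<lambda>_. - 1) \<in> M"
    by (rule cong_mem) (use g(3) in \<open>simp add: mult.commute\<close>)
  then show False using proper by blast
qed

text \<open>Modulo the order defined by M, f is infinitesimally close to c. The values
  assigned to polynomials in this way form a point evaluation.\<close>

definition approx :: "('a \<Rightarrow> real) \<Rightarrow> real \<Rightarrow> bool" where
  "approx f c \<longleftrightarrow> (\<forall>e>0. (\<lambda>z. f z - c + e) \<in> M \<and> (\<lambda>z. c - f z + e) \<in> M)"

lemma approx_cong: "approx f c \<Longrightarrow> (\<And>z. g z = f z) \<Longrightarrow> c = d \<Longrightarrow> approx g d"
  by (metis ext)

lemma approx_const: "approx (\<lambda>_. c) c"
  unfolding approx_def by (auto intro: const_mem)

lemma approx_add:
  assumes "approx f c" "approx g d" shows "approx (\<lambda>z. f z + g z) (c + d)"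
  unfolding approx_def
proof (intro allI impI)
  fix e :: real assume "e > 0"
  then have e: "e/2 > 0" by simp
  note m = assms[unfolded approx_def, rule_format, OF e]
  have "(\<lambda>z. f z + g z - (c + d) + e) \<in> M"
    by (rule cong_mem[OF add_mem[OF conjunct1[OF m(1)] conjunct1[OF m(2)]]]) simp
  moreover have "(\<lambda>z. c + d - (f z + g z) + e) \<in> M"
    by (rule cong_mem[OF add_mem[OF conjunct2[OF m(1)] conjunct2[OF m(2)]]]) simp
  ultimately show "(\<lambda>z. f z + g z - (c + d) + e) \<in> M \<and> (\<lambda>z. c + d - (f z + g z) + e) \<in> M"
    by blast
qed

lemma approx_minus: "approx f c \<Longrightarrow> approx (\<lambda>z. - f z) (- c)"
  unfolding approx_def by (auto simp: algebra_simps)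

lemma approx_scale_pos:
  assumes "approx f c" "k > 0" shows "approx (\<lambda>z. k * f z) (k * c)"
  unfolding approx_def
proof (intro allI impI)
  fix e :: real assume "e > 0"
  then have e: "e/k > 0" using assms by simp
  note m = assms(1)[unfolded approx_def, rule_format, OF e]
  have "(\<lambda>z. k * f z - k * c + e) \<in> M"
    by (rule cong_mem[OF scale_mem[OF less_imp_le[OF assms(2)] conjunct1[OF m]]])
       (use assms(2) in \<open>simp add: field_simps\<close>)
  moreover have "(\<lambda>z. k * c - k * f z + e) \<in> M"
    by (rule cong_mem[OF scale_mem[OF less_imp_le[OF assms(2)] conjunct2[OF m]]])
       (use assms(2) in \<open>simp add: field_simps\<close>)
  ultimately show "(\<lambda>z. k * f z - k * c + e) \<in> M \<and> (\<lambda>z. k * c - k * f z + e) \<in> M" by blast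
qed

lemma approx_scale:
  assumes "approx f c" shows "approx (\<lambda>z. k * f z) (k * c)"
proof -
  consider "k > 0" | "k = 0" | "- k > 0" by linarith
  then show ?thesis
  proof cases
    case 2
    then show ?thesis using approx_const[of 0] by simp
  next
    case 3
    then show ?thesis using approx_minus[OF approx_scale_pos[OF assms 3]] by simp
  qed (use approx_scale_pos assms in blast)
qed

lemma approx_polynomial:
  assumes "approx f c" shows "real_polynomial_function f"
proof -
  have "(\<lambda>z. f z - c + 1) \<in> M" using assms approx_def by auto
  then have "real_polynomial_function (\<lambda>z. (f z - c + 1) + (c - 1))"
    by (intro real_polynomial_intros real_polynomial)
  then show ?thesis by simp
qed

lemma approx_square_zero:
  assumes "approx f 0" shows "approx (\<lambda>z. (f z)\<^sup>2) 0"
  unfolding approx_def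
proof (intro allI impI)
  fix e :: real assume "e > 0"
  then have e: "sqrt e > 0" by simp
  have "(\<lambda>z. (sqrt e)\<^sup>2 - (f z)\<^sup>2) \<in> M"
    using assms[unfolded approx_def, rule_format, OF e] e
    by (intro square_bound) (simp_all add: algebra_simps)
  moreover have "(\<lambda>z. (f z)\<^sup>2 + e) \<in> M"
    using \<open>e > 0\<close> by (intro add_mem square_mem approx_polynomial[OF assms] const_mem) auto
  ultimately show "(\<lambda>z. (f z)\<^sup>2 - 0 + e) \<in> M \<and> (\<lambda>z. 0 - (f z)\<^sup>2 + e) \<in> M"
    using \<open>e > 0\<close> by (simp add: algebra_simps)
qed

text \<open>Reduction to the value 0 by f^2 = (f - c)^2 + 2 c f - c^2.\<close>

lemma approx_square:
  assumes "approx f c" shows "approx (\<lambda>z. (f z)\<^sup>2) (c\<^sup>2)"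
proof -
  have "approx (\<lambda>z. f z + - c) 0"
    by (rule approx_cong[OF approx_add[OF assms approx_const[of "- c"]]]) auto
  from approx_add[OF approx_add[OF approx_square_zero[OF this] approx_scale[OF assms, of "2 * c"]]
      approx_const[of "- c\<^sup>2"]]
  show ?thesis by (rule approx_cong) (simp_all add: power2_eq_square algebra_simps)
qed

lemma approx_mult:
  assumes "approx f c" "approx g d" shows "approx (\<lambda>z. f z * g z) (c * d)"
proof -
  have "approx (\<lambda>z. 1/4 * ((f z + g z)\<^sup>2 + - (f z + - g z)\<^sup>2)) (1/4 * ((c + d)\<^sup>2 + - (c + - d)\<^sup>2))"
    by (intro approx_scale approx_add approx_square approx_minus assms)
  then show ?thesis by (rule approx_cong) (simp_all add: power2_eq_square algebra_simps)
qed

lemma const_mem_nonneg: "(\<lambda>_. c) \<in> M \<Longrightarrow> 0 \<le> c"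
  using negative_const_mem proper by force

lemma approx_mem_nonneg:
  assumes "approx f c" "f \<in> M" shows "0 \<le> c"
proof (rule ccontr)
  assume "\<not> 0 \<le> c"
  then have "- c / 2 > 0" by simp
  then have "(\<lambda>z. c - f z + (- c/2)) \<in> M" using assms(1) unfolding approx_def by blast
  from add_mem[OF this assms(2)] have "(\<lambda>_. c / 2) \<in> M" by (rule cong_mem) auto
  then show False using const_mem_nonneg \<open>\<not> 0 \<le> c\<close> by fastforce
qed

text \<open>The value is the supremum of the constants r with f - r in M, a Dedekind cut. The
  Archimedean property makes this set nonempty and bounded; totality turns the failure of a larger
  constant into the upper estimate.\<close>

lemma approx_exists:
  assumes f: "real_polynomial_function f"
  shows "\<exists>c. approx f c"
proof -
  define L where "L = {r. (\<lambda>z. f z - r) \<in> M}"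
  obtain N where N: "(\<lambda>z. N - f z) \<in> M" "(\<lambda>z. N + f z) \<in> M"
    using archimedean[OF f] bounded_elem_def by blast
  have "- N \<in> L" using N unfolding L_def by (simp add: add.commute)
  have "r \<le> N" if "r \<in> L" for r
  proof -
    have "(\<lambda>z. f z - r) \<in> M" using that L_def by blast
    from add_mem[OF N(1) this] have "(\<lambda>_. N - r) \<in> M" by (rule cong_mem) simp
    then show ?thesis using const_mem_nonneg by fastforce
  qed
  then have bdd: "bdd_above L" by (meson bdd_above.I)
  have "approx f (Sup L)"
    unfolding approx_def
  proof (intro allI impI conjI)
    fix e :: real assume "e > 0"
    obtain r where r: "r \<in> L" "Sup L - e < r"
      using less_cSup_iff[OF _ bdd, of "Sup L - e"] \<open>- N \<in> L\<close> \<open>e > 0\<close> by auto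
    have "(\<lambda>z. (f z - r) + (r - (Sup L - e))) \<in> M"
      using r L_def by (intro add_const_mem) auto
    then show "(\<lambda>z. f z - Sup L + e) \<in> M" by (rule cong_mem) simp
    have "Sup L + e \<notin> L" using cSup_upper[OF _ bdd] \<open>e > 0\<close> by fastforce
    then have "(\<lambda>z. f z - (Sup L + e)) \<notin> M" unfolding L_def by blast
    then have "(\<lambda>z. - (f z - (Sup L + e))) \<in> M"
      using total[OF real_polynomial_function_diff[OF f real_polynomial_function.intros(2)[of "Sup L + e"]]]
      by blast
    then show "(\<lambda>z. Sup L - f z + e) \<in> M" by (rule cong_mem) simp
  qed
  then show ?thesis by blast
qed

text \<open>The values of the coordinate functions form a point w. Since \<open>approx\<close>
  respects sums and products, the value of every polynomial f is f w, and members of M have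
  nonnegative value.\<close>

lemma point_exists: "\<exists>w. \<forall>f\<in>M. 0 \<le> f w"
proof -
  have "\<forall>b::'a. \<exists>c. approx (\<lambda>z. z \<bullet> b) c"
    by (intro allI approx_exists real_polynomial_function.intros(1) bounded_linear_inner_left)
  then obtain c where c: "\<And>b::'a. approx (\<lambda>z. z \<bullet> b) (c b)" by metis
  define w where "w = (\<Sum>b\<in>Basis. c b *\<^sub>R b)"
  have "approx f (f w)" if "real_polynomial_function f" for f
    using that
  proof (induction rule: real_polynomial_function_coordinate_induct)
    case (coordinate b)
    then have "w \<bullet> b = c b" unfolding w_def by (simp add: inner_sum_left_Basis)
    then show ?case using c by simp
  qed (use approx_const approx_add approx_mult in auto)
  then show ?thesis using approx_mem_nonneg real_polynomial by blast
qed

end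

section \<open>Zorn's lemma and Putinar's Positivstellensatz\<close>

context quadratic_module
begin

text \<open>Properness is the absence of the single element -1, so it survives unions of chains and
  Zorn's lemma applies. The Archimedean property passes to larger modules.\<close>

lemma nonneg_point_exists:
  assumes arch: "\<And>f. real_polynomial_function f \<Longrightarrow> bounded_elem f"
    and proper: "(\<lambda>_. - 1) \<notin> M"
  shows "\<exists>w. \<forall>f\<in>M. 0 \<le> f w"
proof -
  define F where "F = {S. quadratic_module S \<and> M \<subseteq> S \<and> (\<lambda>_. - 1) \<notin> S}"
  have "M \<in> F" unfolding F_def using proper quadratic_module_axioms by blast
  have "\<Union>C \<in> F" if C: "C \<noteq> {}" "subset.chain F C" for C
  proof -
    have CF: "S \<in> C \<Longrightarrow> quadratic_module S \<and> M \<subseteq> S \<and> (\<lambda>_. - 1) \<notin> S" for S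
      using C(2) unfolding subset_chain_def F_def by blast
    have "quadratic_module (\<Union>C)"
    proof
      show "real_polynomial_function f" if "f \<in> \<Union>C" for f
        using that CF quadratic_module.real_polynomial by blast
      show "(\<lambda>_. 1) \<in> \<Union>C"
        using C(1) CF quadratic_module.one_mem by blast
      show "(\<lambda>z. f z + g z) \<in> \<Union>C" if fg: "f \<in> \<Union>C" "g \<in> \<Union>C" for f g
      proof -
        obtain S T where ST: "S \<in> C" "T \<in> C" "f \<in> S" "g \<in> T" using fg by blast
        then have "S \<subseteq> T \<or> T \<subseteq> S" using C(2) unfolding subset_chain_def by blast
        then show ?thesis using ST CF quadratic_module.add_mem by blast
      qed
      show "(\<lambda>z. (h z)\<^sup>2 * f z) \<in> \<Union>C" if "real_polynomial_function h" "f \<in> \<Union>C" for h f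
        using that CF quadratic_module.square_mult_mem by blast
    qed
    then show ?thesis using CF C(1) unfolding F_def by blast
  qed
  then obtain S where S: "S \<in> F" "\<And>T. T \<in> F \<Longrightarrow> S \<subseteq> T \<Longrightarrow> T = S"
    using subset_Zorn_nonempty[of F] \<open>M \<in> F\<close> by blast
  have MS: "M \<subseteq> S" and "quadratic_module S" using S F_def by auto
  interpret S: quadratic_module S by fact
  have "maximal_quadratic_module S"
  proof
    show "(\<lambda>_. - 1) \<notin> S" using S F_def by blast
    show "T = S" if "quadratic_module T" "S \<subseteq> T" "(\<lambda>_. - 1) \<notin> T" for T
      using S that MS unfolding F_def by blast
    show "S.bounded_elem f" if "real_polynomial_function f" for f
      using arch[OF that] MS unfolding bounded_elem_def S.bounded_elem_def by blast
  qed
  then show ?thesis using maximal_quadratic_module.point_exists MS by blast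
qed

theorem putinar:
  assumes arch: "\<And>f. real_polynomial_function f \<Longrightarrow> bounded_elem f"
    and f: "real_polynomial_function f"
    and pos: "\<And>w. (\<And>g. g \<in> M \<Longrightarrow> 0 \<le> g w) \<Longrightarrow> 0 < f w"
  shows "f \<in> M"
proof -
  \<comment> \<open>A point where all of \<open>?E\<close> is nonnegative would satisfy both f > 0
    and -f >= 0. Hence \<open>?E\<close> contains -1, which is exactly a sum of squares s with s f -
    1 in M.\<close>
  let ?E = "extension (\<lambda>z. - f z)"
  interpret E: quadratic_module ?E
    by (intro quadratic_module_extend real_polynomial_intros f)
  note ME = extension_subset[of "\<lambda>z. - f z"]
  have "(\<lambda>z. - f z) \<in> ?E" by (rule extension_mem)
  then have empty: "\<not> (\<forall>g\<in>?E. 0 \<le> g w)" for w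
    using pos[of w] ME by (metis in_mono neg_0_le_iff_le not_le)
  have "E.bounded_elem g" if "real_polynomial_function g" for g
    using arch[OF that] ME unfolding bounded_elem_def E.bounded_elem_def by blast
  then have "(\<lambda>_. - 1) \<in> ?E"
    using E.nonneg_point_exists empty by metis
  then obtain g s where "g \<in> M" and s: "s \<in> sums_of_squares" and "(\<lambda>_. - 1) = (\<lambda>z. g z + s z * - f z)"
    unfolding extension_def by blast
  then have eq: "- 1 = g z + s z * - f z" for z by meson
  have sf: "(\<lambda>z. s z * f z - 1) \<in> M"
    by (rule cong_mem[OF \<open>g \<in> M\<close>]) (use eq in \<open>simp add: algebra_simps\<close>)
  have sp: "real_polynomial_function s" using s by (rule sos.real_polynomial)
  obtain A where A: "(\<lambda>z. A - (s z)\<^sup>2 * f z) \<in> M"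
    using arch[OF real_polynomial_function.intros(4)[OF real_polynomial_function_power[OF sp] f]]
    unfolding bounded_elem_def by blast
  obtain B where B: "(\<lambda>z. B - s z) \<in> M" using arch[OF sp] bounded_elem_def by blast
  obtain R where R: "(\<lambda>z. R + f z) \<in> M" using arch[OF f] bounded_elem_def by blast
  \<comment> \<open>Chosen so that both 2k - B and 2k - 1 - A are nonnegative constants, as the two
    uses below require.\<close>
  define k where "k = \<bar>A\<bar> + \<bar>B\<bar> + 1"
  have k: "k > 0" "A + 1 \<le> 2 * k" "B \<le> 2 * k" unfolding k_def by (auto simp: abs_if)
  \<comment> \<open>Again a product of members, s and 2k - s; it equals k^2 - (k - s)^2, so
    \<open>square_bound\<close> applies to k - s.\<close>
  have s_bound: "(\<lambda>z. s z * (2 * k - s z)) \<in> M"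
  proof -
    have "(\<lambda>z. k - (k - s z)) \<in> M" by (rule cong_mem[OF sos_mem[OF s]]) simp
    moreover have "(\<lambda>z. k + (k - s z)) \<in> M"
      by (rule cong_mem[OF add_const_mem[OF _ B, of "2 * k - B"]]) (use k in auto)
    ultimately have "(\<lambda>z. k\<^sup>2 - (k - s z)\<^sup>2) \<in> M" by (rule square_bound[OF k(1)])
    then show ?thesis by (rule cong_mem) (simp add: power2_eq_square algebra_simps)
  qed
  text \<open>The step length depends only on k, so finitely many steps bring r down to 0.\<close>
  have step: "(\<lambda>z. f z + (r - 1 / k\<^sup>2)) \<in> M" if "(\<lambda>z. f z + r) \<in> M" "r \<ge> 0" for r
  proof -
    \<comment> \<open>Compare k^2 (f + r) with (k - s)^2 (f + r), which is in M. The difference s(2k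
      - s)(f + r) equals 2k s f - s^2 f + r s(2k - s). Its terms are controlled by
      \<open>sf\<close>, \<open>A\<close> and \<open>s_bound\<close>, with a surplus of 1 that
      lowers r by 1 / k^2.\<close>
    have "(\<lambda>z. 1 / k\<^sup>2 * ((k - s z)\<^sup>2 * (f z + r) + 2 * k * (s z * f z - 1)
        + ((A - (s z)\<^sup>2 * f z) + (2 * k - 1 - A)) + r * (s z * (2 * k - s z)))) \<in> M"
      by (intro scale_mem add_mem[OF add_mem[OF add_mem]] scale_mem[OF _ sf] scale_mem[OF _ s_bound]
          add_const_mem[OF _ A] square_mult_mem[OF _ that(1)] real_polynomial_intros sp)
         (use k that(2) in simp_all)
    then show ?thesis
    proof (rule cong_mem)
      fix z
      have "(k - s z)\<^sup>2 * (f z + r) + 2 * k * (s z * f z - 1)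
        + ((A - (s z)\<^sup>2 * f z) + (2 * k - 1 - A)) + r * (s z * (2 * k - s z)) = k\<^sup>2 * (f z + r) - 1"
        by algebra
      then show "f z + (r - 1 / k\<^sup>2) = 1 / k\<^sup>2 * ((k - s z)\<^sup>2 * (f z + r) + 2 * k * (s z * f z - 1)
        + ((A - (s z)\<^sup>2 * f z) + (2 * k - 1 - A)) + r * (s z * (2 * k - s z)))"
        using k by (simp add: field_simps)
    qed
  qed
  \<comment> \<open>Truncation at 0 preserves the condition r >= 0 of \<open>step\<close>.\<close>
  have descend: "(\<lambda>z. f z + max 0 (\<bar>R\<bar> - real n / k\<^sup>2)) \<in> M" for n
  proof (induction n)
    case 0
    show ?case
      by (rule cong_mem[OF add_const_mem[OF _ R, of "\<bar>R\<bar> - R"]]) auto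
  next
    case (Suc n)
    let ?r = "max 0 (\<bar>R\<bar> - real n / k\<^sup>2)" and ?r' = "max 0 (\<bar>R\<bar> - real (Suc n) / k\<^sup>2)"
    have "real (Suc n) / k\<^sup>2 = real n / k\<^sup>2 + 1 / k\<^sup>2" "1 / k\<^sup>2 \<ge> 0"
      by (simp_all add: add_divide_distrib)
    then have "0 \<le> ?r' - (?r - 1 / k\<^sup>2)" by linarith
    from add_const_mem[OF this step[OF Suc]]
    show ?case by (rule cong_mem) simp_all
  qed
  obtain n where "\<bar>R\<bar> * k\<^sup>2 \<le> real n" using real_arch_simple by blast
  then have "\<bar>R\<bar> - real n / k\<^sup>2 \<le> 0" using k by (simp add: field_simps)
  then show ?thesis using descend[of n] by simp
qed

end

section \<open>Polynomial functions and monomial expansions\<close>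

text \<open>Abstracts an exponent monoid with additive degree, so that the expansions in q and in
  (q, x, y) are handled together.\<close>

locale graded_monomials =
  fixes mon :: "'e \<Rightarrow> 'z \<Rightarrow> real" and deg :: "'e \<Rightarrow> nat" and unit :: 'e and mul :: "'e \<Rightarrow> 'e \<Rightarrow> 'e"
  assumes mon_unit: "mon unit z = 1" and deg_unit: "deg unit = 0"
    and mon_mul: "mon (mul e e') z = mon e z * mon e' z"
    and deg_mul: "deg (mul e e') = deg e + deg e'"
begin

definition expansion :: "int \<Rightarrow> ('z \<Rightarrow> real) \<Rightarrow> bool" where
  "expansion k f \<longleftrightarrow> (\<exists>c. finite {e. c e \<noteq> 0} \<and> (\<forall>e. c e \<noteq> 0 \<longrightarrow> int (deg e) \<le> k) \<and>
     (\<forall>z. f z = (\<Sum>e\<in>{e. c e \<noteq> 0}. c e * mon e z)))"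

text \<open>The index map g may repeat monomials, as happens for sums and products. Coefficients are
  collected over the fibres of g; cancellation only shrinks the support.\<close>

lemma expansionI:
  assumes fin: "finite I" and deg: "\<And>i. i \<in> I \<Longrightarrow> int (deg (g i)) \<le> k"
    and f: "\<And>z. f z = (\<Sum>i\<in>I. a i * mon (g i) z)"
  shows "expansion k f"
proof -
  define c where "c e = (\<Sum>i\<in>{i\<in>I. g i = e}. a i)" for e
  have supp: "{e. c e \<noteq> 0} \<subseteq> g ` I"
  proof
    fix e assume "e \<in> {e. c e \<noteq> 0}"
    then have "{i\<in>I. g i = e} \<noteq> {}" unfolding c_def by (metis (mono_tags) mem_Collect_eq sum.empty)
    then show "e \<in> g ` I" by blast
  qed
  have "f z = (\<Sum>e\<in>{e. c e \<noteq> 0}. c e * mon e z)" for z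
  proof -
    have "f z = (\<Sum>e\<in>g ` I. \<Sum>i\<in>{i\<in>I. g i = e}. a i * mon (g i) z)"
      unfolding f by (rule sum.image_gen[OF fin])
    also have "\<dots> = (\<Sum>e\<in>g ` I. c e * mon e z)"
      unfolding c_def sum_distrib_right by (intro sum.cong) auto
    also have "\<dots> = (\<Sum>e\<in>{e. c e \<noteq> 0}. c e * mon e z)"
      using supp fin by (intro sum.mono_neutral_right) auto
    finally show ?thesis .
  qed
  moreover have "finite {e. c e \<noteq> 0}" using supp fin finite_surj by blast
  moreover have "\<forall>e. c e \<noteq> 0 \<longrightarrow> int (deg e) \<le> k" using supp deg by blast
  ultimately show ?thesis unfolding expansion_def by blast
qed

lemma expansion_mono: "expansion k f \<Longrightarrow> k \<le> l \<Longrightarrow> expansion l f"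
  unfolding expansion_def by (meson order_trans)

lemma expansion_mon: "expansion (int (deg e)) (mon e)"
  by (rule expansionI[of "{()}" "\<lambda>_. e" _ _ "\<lambda>_. 1"]) auto

lemma expansion_const: "0 \<le> k \<Longrightarrow> expansion k (\<lambda>_. c)"
  by (rule expansionI[of "{()}" "\<lambda>_. unit" _ _ "\<lambda>_. c"]) (auto simp: mon_unit deg_unit)

lemma expansion_zero: "expansion k (\<lambda>_. 0)"
  by (rule expansionI[of "{}"]) auto

lemma expansion_add:
  assumes "expansion k f" "expansion k g" shows "expansion k (\<lambda>z. f z + g z)"
proof -
  obtain c where c: "finite {e. c e \<noteq> 0}" "\<And>e. c e \<noteq> 0 \<Longrightarrow> int (deg e) \<le> k"
    "\<And>z. f z = (\<Sum>e\<in>{e. c e \<noteq> 0}. c e * mon e z)"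
    using assms(1) expansion_def by auto
  obtain d where d: "finite {e. d e \<noteq> 0}" "\<And>e. d e \<noteq> 0 \<Longrightarrow> int (deg e) \<le> k"
    "\<And>z. g z = (\<Sum>e\<in>{e. d e \<noteq> 0}. d e * mon e z)"
    using assms(2) expansion_def by auto
  show ?thesis
    by (rule expansionI[of "{e. c e \<noteq> 0} <+> {e. d e \<noteq> 0}" "case_sum id id" _ _ "case_sum c d"])
       (use c d in \<open>auto simp: sum.Plus\<close>)
qed

lemma expansion_mult:
  assumes "expansion k f" "expansion l g" shows "expansion (k + l) (\<lambda>z. f z * g z)"
proof -
  obtain c where c: "finite {e. c e \<noteq> 0}" "\<And>e. c e \<noteq> 0 \<Longrightarrow> int (deg e) \<le> k"
    "\<And>z. f z = (\<Sum>e\<in>{e. c e \<noteq> 0}. c e * mon e z)"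
    using assms(1) expansion_def by auto
  obtain d where d: "finite {e. d e \<noteq> 0}" "\<And>e. d e \<noteq> 0 \<Longrightarrow> int (deg e) \<le> l"
    "\<And>z. g z = (\<Sum>e\<in>{e. d e \<noteq> 0}. d e * mon e z)"
    using assms(2) expansion_def by auto
  show ?thesis
  proof (rule expansionI[of "{e. c e \<noteq> 0} \<times> {e. d e \<noteq> 0}" "\<lambda>(e, e'). mul e e'" _ _ "\<lambda>(e, e'). c e * d e'"])
    fix z
    show "f z * g z = (\<Sum>i\<in>{e. c e \<noteq> 0} \<times> {e. d e \<noteq> 0}.
        (case i of (e, e') \<Rightarrow> c e * d e') * mon (case i of (e, e') \<Rightarrow> mul e e') z)"
      unfolding c(3) d(3) sum_product sum.cartesian_product
      by (intro sum.cong) (auto simp: mon_mul)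
  next
    fix i assume "i \<in> {e. c e \<noteq> 0} \<times> {e. d e \<noteq> 0}"
    then show "int (deg (case i of (e, e') \<Rightarrow> mul e e')) \<le> k + l"
      using add_mono[OF c(2)[of "fst i"] d(2)[of "snd i"]] by (auto simp: deg_mul)
  qed (use c d in auto)
qed

end

lemma graded_monomials_expansion:
  fixes mon :: "'e \<Rightarrow> 'z::euclidean_space \<Rightarrow> real"
  assumes "graded_monomials mon deg unit mul"
    and coordinate: "\<And>b. b \<in> Basis \<Longrightarrow> \<exists>e. mon e = (\<lambda>z. z \<bullet> b)"
    and "real_polynomial_function p"
  shows "\<exists>k. graded_monomials.expansion mon deg k p"
proof -
  interpret graded_monomials mon deg unit mul by fact
  show ?thesis
    using assms(3)
  proof (induction rule: real_polynomial_function_coordinate_induct)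
    case (coordinate b)
    then show ?case using assms(2) expansion_mon by metis
  next
    case (const c)
    then show ?case using expansion_const by blast
  next
    case (add f g)
    then obtain k l where "expansion k f" "expansion l g" by blast
    then have "expansion (max k l) f" "expansion (max k l) g" using expansion_mono by auto
    then show ?case using expansion_add by blast
  next
    case (mult f g)
    then show ?case using expansion_mult by blast
  qed
qed

interpretation q: graded_monomials mono_q "\<lambda>e :: 'n::finite \<Rightarrow> nat. sum e UNIV" "\<lambda>_. 0"
    "\<lambda>e e' i. e i + e' i"
  by unfold_locales (auto simp: mono_q_def power_add prod.distrib sum.distrib)

interpretation qxy: graded_monomials "\<lambda>e z. mono_qxy e (fst z) (fst (snd z)) (snd (snd z))"
    "deg_qxy :: ('n::finite \<Rightarrow> nat) \<times> nat \<times> nat \<Rightarrow> nat" "(\<lambda>_. 0, 0, 0)"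
    "\<lambda>e e'. (\<lambda>i. fst e i + fst e' i, fst (snd e) + fst (snd e'), snd (snd e) + snd (snd e'))"
  by unfold_locales
     (auto simp: mono_qxy_def deg_qxy_def mono_q_def power_add prod.distrib sum.distrib)

lemma poly_q_expansion: "poly_q k f \<longleftrightarrow> q.expansion k f"
  unfolding poly_q_def q.expansion_def ..

lemma poly_qxy_expansion:
  "poly_qxy k f \<longleftrightarrow> qxy.expansion k (\<lambda>z. f (fst z) (fst (snd z)) (snd (snd z)))"
  unfolding poly_qxy_def qxy.expansion_def by simp

lemma mono_q_unit_exponent: "mono_q (\<lambda>j. if j = i then 1 else 0) q = q $ i"
proof -
  have "mono_q (\<lambda>j. if j = i then 1 else 0) q = (\<Prod>j\<in>UNIV. if i = j then q $ j else 1)"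
    unfolding mono_q_def by (intro prod.cong) auto
  then show ?thesis by simp
qed

lemma real_polynomial_function_vec_nth: "real_polynomial_function (\<lambda>q::real^'n::finite. q $ i)"
  by (intro real_polynomial_function.intros(1) bounded_linear_vec_nth)

lemma real_polynomial_poly_q:
  assumes "real_polynomial_function p" shows "\<exists>k. poly_q k p"
  unfolding poly_q_expansion
proof (rule graded_monomials_expansion[OF q.graded_monomials_axioms _ assms])
  fix b :: "real^'n" assume "b \<in> Basis"
  then obtain i where "b = axis i 1" by (auto simp: Basis_vec_def)
  then show "\<exists>e. mono_q e = (\<lambda>z. z \<bullet> b)"
    using mono_q_unit_exponent[of i] by (auto simp: inner_axis)
qed

lemma poly_q_real_polynomial:
  assumes "poly_q k p" shows "real_polynomial_function p"
proof -
  obtain c where c: "finite {e. c e \<noteq> 0}" "\<And>q. p q = (\<Sum>e\<in>{e. c e \<noteq> 0}. c e * mono_q e q)"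
    using assms unfolding poly_q_def by auto
  have "real_polynomial_function (\<lambda>q. \<Sum>e\<in>{e. c e \<noteq> 0}. c e * mono_q e q)"
    unfolding mono_q_def
    by (intro real_polynomial_function_sum c real_polynomial_intros real_polynomial_function_prod
        real_polynomial_function_vec_nth) auto
  then show ?thesis using c(2) by presburger
qed

lemma Basis_qxy_cases:
  assumes "b \<in> (Basis :: ((real^'n) \<times> real \<times> real) set)"
  obtains i where "\<And>z. z \<bullet> b = fst z $ i" | "\<And>z. z \<bullet> b = fst (snd z)" | "\<And>z. z \<bullet> b = snd (snd z)"
proof -
  consider i where "b = (axis i 1, 0, 0)" | "b = (0, 1, 0)" | "b = (0, 0, 1)"
    using assms by (auto simp: Basis_prod_def Basis_vec_def zero_prod_def)
  then show thesis
    by cases (use that in \<open>auto simp: inner_prod_def inner_axis\<close>)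
qed

lemma real_polynomial_poly_qxy:
  fixes p :: "(real^'n::finite) \<times> real \<times> real \<Rightarrow> real"
  assumes "real_polynomial_function p" shows "\<exists>k. poly_qxy k (\<lambda>q x y. p (q, x, y))"
proof -
  have "\<exists>k. qxy.expansion k p"
  proof (rule graded_monomials_expansion[OF qxy.graded_monomials_axioms _ assms])
    fix b :: "(real^'n) \<times> real \<times> real" assume "b \<in> Basis"
    then show "\<exists>e. (\<lambda>z. mono_qxy e (fst z) (fst (snd z)) (snd (snd z))) = (\<lambda>z. z \<bullet> b)"
    proof (cases rule: Basis_qxy_cases)
      case (1 i)
      then show ?thesis
        using mono_q_unit_exponent[of i]
        by (intro exI[of _ "(\<lambda>j. if j = i then 1 else 0, 0, 0)"]) (simp add: mono_qxy_def)
    next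
      case 2
      then show ?thesis
        by (intro exI[of _ "(\<lambda>_. 0, 1, 0)"]) (simp add: mono_qxy_def mono_q_def)
    next
      case 3
      then show ?thesis
        by (intro exI[of _ "(\<lambda>_. 0, 0, 1)"]) (simp add: mono_qxy_def mono_q_def)
    qed
  qed
  then show ?thesis by (simp add: poly_qxy_expansion)
qed

text \<open>Also covers negative k, which occurs when 2d < m.\<close>

lemma poly_qxy_zero: "poly_qxy k (\<lambda>_ _ _. 0)"
  unfolding poly_qxy_expansion by (rule qxy.expansion_zero)

lemma poly_qxy_add: "poly_qxy k f \<Longrightarrow> poly_qxy k g \<Longrightarrow> poly_qxy k (\<lambda>q x y. f q x y + g q x y)"
  unfolding poly_qxy_expansion by (rule qxy.expansion_add)

lemma poly_qxy_mono: "poly_qxy k f \<Longrightarrow> k \<le> l \<Longrightarrow> poly_qxy l f"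
  unfolding poly_qxy_expansion by (rule qxy.expansion_mono)

lemma sos_qxy_zero: "sos_qxy D (\<lambda>_ _ _. 0)"
  unfolding sos_qxy_def by (rule exI[of _ "[]"]) auto

lemma sos_qxy_square: "poly_qxy (D div 2) g \<Longrightarrow> sos_qxy D (\<lambda>q x y. (g q x y)\<^sup>2)"
  unfolding sos_qxy_def by (rule exI[of _ "[g]"]) auto

lemma sos_qxy_add:
  assumes "sos_qxy D f" "sos_qxy D g" shows "sos_qxy D (\<lambda>q x y. f q x y + g q x y)"
proof -
  obtain fs gs where "\<forall>h\<in>set fs. poly_qxy (D div 2) h" "\<forall>q x y. f q x y = (\<Sum>h\<leftarrow>fs. (h q x y)\<^sup>2)"
    "\<forall>h\<in>set gs. poly_qxy (D div 2) h" "\<forall>q x y. g q x y = (\<Sum>h\<leftarrow>gs. (h q x y)\<^sup>2)"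
    using assms unfolding sos_qxy_def by auto
  then show ?thesis unfolding sos_qxy_def by (intro exI[of _ "fs @ gs"]) auto
qed

lemma sos_qxy_nonneg: "sos_qxy D f \<Longrightarrow> 0 \<le> f q x y"
  unfolding sos_qxy_def by (auto intro!: sum_list_nonneg)

section \<open>Certificates\<close>

text \<open>The feasibility identity with an arbitrary left-hand side in (q, x, y). This generality
  makes certificates additive, so that they can be built by induction over the generated
  module.\<close>

definition certificate ::
  "(nat \<Rightarrow> real^'n::finite \<Rightarrow> real) \<Rightarrow> nat \<Rightarrow> nat \<Rightarrow> ((real^'n) \<times> real \<times> real \<Rightarrow> real) \<Rightarrow> bool" where
  "certificate pk m d f \<longleftrightarrow>
     (\<exists>\<sigma>0 (\<sigma> :: 'n \<Rightarrow> real^'n \<Rightarrow> real \<Rightarrow> real \<Rightarrow> real) \<tau>R \<tau>I.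
        sos_qxy (2 * int d) \<sigma>0 \<and> (\<forall>j. sos_qxy (2 * int d - 2) (\<sigma> j)) \<and>
        poly_qxy (2 * int d - int m) \<tau>R \<and> poly_qxy (2 * int d - int m) \<tau>I \<and>
        (\<forall>q x y. f (q, x, y) = \<sigma>0 q x y + (\<Sum>j\<in>UNIV. \<sigma> j q x y * (1 - (q $ j)\<^sup>2))
                    + \<tau>R q x y * pRe pk m q x y + \<tau>I q x y * pIm pk m q x y))"

lemma feasible_iff_certificate:
  "feasible pk m d v \<longleftrightarrow> poly_q (2 * int d) v \<and> certificate pk m d (\<lambda>z. v (fst z) - fst (snd z))"
  unfolding feasible_def certificate_def by simp

lemma certificate_add:
  assumes "certificate pk m d f" "certificate pk m d g"
  shows "certificate pk m d (\<lambda>z. f z + g z)"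
proof -
  obtain a0 a aR aI where a: "sos_qxy (2 * int d) a0" "\<forall>j. sos_qxy (2 * int d - 2) (a j)"
    "poly_qxy (2 * int d - int m) aR" "poly_qxy (2 * int d - int m) aI"
    "\<forall>q x y. f (q, x, y) = a0 q x y + (\<Sum>j\<in>UNIV. a j q x y * (1 - (q $ j)\<^sup>2))
                    + aR q x y * pRe pk m q x y + aI q x y * pIm pk m q x y"
    using assms(1) unfolding certificate_def by blast
  obtain b0 b bR bI where b: "sos_qxy (2 * int d) b0" "\<forall>j. sos_qxy (2 * int d - 2) (b j)"
    "poly_qxy (2 * int d - int m) bR" "poly_qxy (2 * int d - int m) bI"
    "\<forall>q x y. g (q, x, y) = b0 q x y + (\<Sum>j\<in>UNIV. b j q x y * (1 - (q $ j)\<^sup>2))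
                    + bR q x y * pRe pk m q x y + bI q x y * pIm pk m q x y"
    using assms(2) unfolding certificate_def by blast
  show ?thesis
    unfolding certificate_def
    by (rule exI[of _ "\<lambda>q x y. a0 q x y + b0 q x y"], rule exI[of _ "\<lambda>j q x y. a j q x y + b j q x y"],
        rule exI[of _ "\<lambda>q x y. aR q x y + bR q x y"], rule exI[of _ "\<lambda>q x y. aI q x y + bI q x y"])
       (auto simp: sos_qxy_add poly_qxy_add a b distrib_right sum.distrib)
qed

text \<open>Each equation enters as two opposite inequalities, which puts the real and imaginary
  parts of p in the support, hence all their polynomial multiples in the module.\<close>

definition constraints ::
  "(nat \<Rightarrow> real^'n::finite \<Rightarrow> real) \<Rightarrow> nat \<Rightarrow> ((real^'n) \<times> real \<times> real \<Rightarrow> real) set" where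
  "constraints pk m = range (\<lambda>j z. 1 - (fst z $ j)\<^sup>2)
     \<union> {\<lambda>z. pRe pk m (fst z) (fst (snd z)) (snd (snd z)), \<lambda>z. - pRe pk m (fst z) (fst (snd z)) (snd (snd z)),
        \<lambda>z. pIm pk m (fst z) (fst (snd z)) (snd (snd z)), \<lambda>z. - pIm pk m (fst z) (fst (snd z)) (snd (snd z))}"

lemma certificate_square:
  assumes "poly_qxy (int d) (\<lambda>q x y. h (q, x, y))"
  shows "certificate pk m d (\<lambda>z. (h z)\<^sup>2)"
  unfolding certificate_def
  by (rule exI[of _ "\<lambda>q x y. (h (q, x, y))\<^sup>2"], rule exI[of _ "\<lambda>_ _ _ _. 0"],
      rule exI[of _ "\<lambda>_ _ _. 0"], rule exI[of _ "\<lambda>_ _ _. 0"])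
     (use assms in \<open>auto simp: sos_qxy_zero poly_qxy_zero intro!: sos_qxy_square\<close>)

lemma certificate_box:
  assumes "poly_qxy (int d - 1) (\<lambda>q x y. h (q, x, y))"
  shows "certificate pk m d (\<lambda>z. (h z)\<^sup>2 * (1 - (fst z $ i)\<^sup>2))"
  unfolding certificate_def
proof (rule exI[of _ "\<lambda>_ _ _. 0"], rule exI[of _ "\<lambda>j q x y. if j = i then (h (q, x, y))\<^sup>2 else 0"],
    rule exI[of _ "\<lambda>_ _ _. 0"], rule exI[of _ "\<lambda>_ _ _. 0"], intro conjI allI)
  have "(2 * int d - 2) div 2 = int d - 1" by presburger
  then show "sos_qxy (2 * int d - 2) (\<lambda>q x y. if j = i then (h (q, x, y))\<^sup>2 else 0)" for j
    using assms by (cases "j = i") (auto simp: sos_qxy_zero intro!: sos_qxy_square)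
next
  fix q :: "real^'a" and x y
  have "(\<Sum>j\<in>UNIV. (if j = i then (h (q, x, y))\<^sup>2 else 0) * (1 - (q $ j)\<^sup>2))
      = (\<Sum>j\<in>UNIV. if j = i then (h (q, x, y))\<^sup>2 * (1 - (q $ j)\<^sup>2) else 0)"
    by (intro sum.cong) auto
  then show "(h (q, x, y))\<^sup>2 * (1 - (fst (q, x, y) $ i)\<^sup>2) =
     0 + (\<Sum>j\<in>UNIV. (if j = i then (h (q, x, y))\<^sup>2 else 0) * (1 - (q $ j)\<^sup>2))
       + 0 * pRe pk m q x y + 0 * pIm pk m q x y"
    by simp
qed (auto simp: sos_qxy_zero poly_qxy_zero)

lemma certificate_ideal:
  assumes "poly_qxy (2 * int d - int m) (\<lambda>q x y. h (q, x, y))"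
  shows "certificate pk m d (\<lambda>z. h z * pRe pk m (fst z) (fst (snd z)) (snd (snd z)))"
    "certificate pk m d (\<lambda>z. h z * pIm pk m (fst z) (fst (snd z)) (snd (snd z)))"
  unfolding certificate_def
  subgoal
    by (rule exI[of _ "\<lambda>_ _ _. 0"], rule exI[of _ "\<lambda>_ _ _ _. 0"],
        rule exI[of _ "\<lambda>q x y. h (q, x, y)"], rule exI[of _ "\<lambda>_ _ _. 0"])
       (use assms in \<open>auto simp: sos_qxy_zero poly_qxy_zero\<close>)
  subgoal
    by (rule exI[of _ "\<lambda>_ _ _. 0"], rule exI[of _ "\<lambda>_ _ _ _. 0"],
        rule exI[of _ "\<lambda>_ _ _. 0"], rule exI[of _ "\<lambda>q x y. h (q, x, y)"])
       (use assms in \<open>auto simp: sos_qxy_zero poly_qxy_zero\<close>)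
  done

text \<open>A member involves finitely many multipliers, so all degree bounds hold once d is large.
  For the equations the sign of the generator is absorbed into the multiplier, which may be any
  polynomial.\<close>

lemma certificate_exists:
  fixes f :: "(real^'n::finite) \<times> real \<times> real \<Rightarrow> real"
  assumes "f \<in> generated_module (constraints pk m)"
  shows "\<exists>D. \<forall>d\<ge>D. certificate pk m d f"
  using assms
proof induction
  case (square h)
  obtain k where k: "poly_qxy k (\<lambda>q x y. h (q, x, y))" using real_polynomial_poly_qxy[OF square] by blast
  show ?case
    by (rule exI[of _ "nat k"]) (auto intro!: certificate_square poly_qxy_mono[OF k])
next
  case (generator g h)
  obtain k where k: "poly_qxy k (\<lambda>q x y. h (q, x, y))"
    using real_polynomial_poly_qxy[OF generator(2)] by blast
  have "real_polynomial_function (\<lambda>z. (h z)\<^sup>2)" "real_polynomial_function (\<lambda>z. - (h z)\<^sup>2)"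
    by (intro real_polynomial_intros generator(2))+
  then obtain l1 l2 where "poly_qxy l1 (\<lambda>q x y. (h (q, x, y))\<^sup>2)" "poly_qxy l2 (\<lambda>q x y. - (h (q, x, y))\<^sup>2)"
    using real_polynomial_poly_qxy by blast
  then obtain l where l: "poly_qxy l (\<lambda>q x y. (h (q, x, y))\<^sup>2)" "poly_qxy l (\<lambda>q x y. - (h (q, x, y))\<^sup>2)"
    using poly_qxy_mono[of l1 _ "max l1 l2"] poly_qxy_mono[of l2 _ "max l1 l2"] by auto
  have l': "poly_qxy (2 * int d - int m) (\<lambda>q x y. (h (q, x, y))\<^sup>2)"
    "poly_qxy (2 * int d - int m) (\<lambda>q x y. - (h (q, x, y))\<^sup>2)" if "d \<ge> nat l + m" for d
    using that by (auto intro!: poly_qxy_mono[OF l(1)] poly_qxy_mono[OF l(2)])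
  show ?case
  proof (intro exI allI impI)
    \<comment> \<open>The first summand gives k <= d - 1 for the box multipliers, the second gives l
      <= 2d - m for the ideal multipliers.\<close>
    fix d assume d: "d \<ge> (nat k + 1) + (nat l + m)"
    from generator(1) consider i where "g = (\<lambda>z. 1 - (fst z $ i)\<^sup>2)"
      | "g = (\<lambda>z. pRe pk m (fst z) (fst (snd z)) (snd (snd z)))"
      | "g = (\<lambda>z. - pRe pk m (fst z) (fst (snd z)) (snd (snd z)))"
      | "g = (\<lambda>z. pIm pk m (fst z) (fst (snd z)) (snd (snd z)))"
      | "g = (\<lambda>z. - pIm pk m (fst z) (fst (snd z)) (snd (snd z)))"
      unfolding constraints_def by auto
    then show "certificate pk m d (\<lambda>z. (h z)\<^sup>2 * g z)"
    proof cases
      case (1 i)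
      then show ?thesis using d by (auto intro!: certificate_box poly_qxy_mono[OF k])
    next
      case 2
      then show ?thesis using certificate_ideal(1)[OF l'(1)] d by simp
    next
      case 3
      then show ?thesis using certificate_ideal(1)[of d m "\<lambda>z. - (h z)\<^sup>2"] l'(2) d by simp
    next
      case 4
      then show ?thesis using certificate_ideal(2)[OF l'(1)] d by simp
    next
      case 5
      then show ?thesis using certificate_ideal(2)[of d m "\<lambda>z. - (h z)\<^sup>2"] l'(2) d by simp
    qed
  qed
next
  case (add f g)
  then obtain D E where "\<forall>d\<ge>D. certificate pk m d f" "\<forall>d\<ge>E. certificate pk m d g" by blast
  then show ?case by (intro exI[of _ "max D E"]) (auto intro: certificate_add)
qed

section \<open>Boundedness of the roots\<close>

lemma real_polynomial_Re_Im_sum: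
  assumes "finite I" "\<And>i. i \<in> I \<Longrightarrow> real_polynomial_function (\<lambda>z. Re (f i z))"
    "\<And>i. i \<in> I \<Longrightarrow> real_polynomial_function (\<lambda>z. Im (f i z))"
  shows "real_polynomial_function (\<lambda>z. Re (\<Sum>i\<in>I. f i z))"
    "real_polynomial_function (\<lambda>z. Im (\<Sum>i\<in>I. f i z))"
  using assms unfolding Re_sum Im_sum by (auto intro!: real_polynomial_function_sum)

lemma real_polynomial_Re_Im_mult:
  assumes "real_polynomial_function (\<lambda>z. Re (f z))" "real_polynomial_function (\<lambda>z. Im (f z))"
    "real_polynomial_function (\<lambda>z. Re (g z))" "real_polynomial_function (\<lambda>z. Im (g z))"
  shows "real_polynomial_function (\<lambda>z. Re (f z * g z))"
    "real_polynomial_function (\<lambda>z. Im (f z * g z))"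
  unfolding times_complex.simps by (intro real_polynomial_intros assms)+

lemma real_polynomial_Re_Im_power:
  assumes "real_polynomial_function (\<lambda>z. Re (f z))" "real_polynomial_function (\<lambda>z. Im (f z))"
  shows "real_polynomial_function (\<lambda>z. Re (f z ^ n)) \<and> real_polynomial_function (\<lambda>z. Im (f z ^ n))"
proof (induction n)
  case 0
  then show ?case by (simp add: real_polynomial_function.intros(2))
next
  case (Suc n)
  show ?case
    unfolding power_Suc
    by (intro conjI real_polynomial_Re_Im_mult[OF assms conjunct1[OF Suc.IH] conjunct2[OF Suc.IH]])
qed

lemma real_polynomial_compose_fst:
  assumes "real_polynomial_function p"
  shows "real_polynomial_function (\<lambda>z::'a::real_normed_vector \<times> 'b::real_normed_vector. p (fst z))"
  using real_polynomial_function_compose[OF polynomial_function_bounded_linear[OF bounded_linear_fst] assms]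
  by (simp add: o_def)

definition croot :: "(real^'n::finite) \<times> real \<times> real \<Rightarrow> complex" where
  "croot z = Complex (fst (snd z)) (snd (snd z))"

lemma real_polynomial_croot:
  "real_polynomial_function (\<lambda>z::(real^'n::finite) \<times> real \<times> real. Re (croot z))"
  "real_polynomial_function (\<lambda>z::(real^'n::finite) \<times> real \<times> real. Im (croot z))"
  unfolding croot_def complex.sel
  by (intro real_polynomial_function.intros(1) bounded_linear_fst_comp bounded_linear_snd_comp
      bounded_linear_fst bounded_linear_snd)+

locale monic_family =
  fixes pk :: "nat \<Rightarrow> real^'n::finite \<Rightarrow> real" and m :: nat
  assumes m_pos: "1 \<le> m"
    and coefficient: "k \<le> m \<Longrightarrow> real_polynomial_function (pk k)"
    and monic: "pk m q = 1"
begin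

abbreviation M where "M \<equiv> generated_module (constraints pk m)"

abbreviation PR where "PR \<equiv> \<lambda>z. Re (pc pk m (fst z) (croot z))"
abbreviation PI where "PI \<equiv> \<lambda>z. Im (pc pk m (fst z) (croot z))"

text \<open>For j = m this is p(q, s) - s^m; smaller j serve the induction in
  \<open>tail_bound\<close>.\<close>

definition tail :: "nat \<Rightarrow> (real^'n) \<times> real \<times> real \<Rightarrow> complex" where
  "tail j z = (\<Sum>k<j. complex_of_real (pk k (fst z)) * croot z ^ k)"

lemma real_polynomial_term:
  assumes "k \<le> m"
  shows "real_polynomial_function (\<lambda>z. Re (complex_of_real (pk k (fst z)) * croot z ^ k))"
    "real_polynomial_function (\<lambda>z. Im (complex_of_real (pk k (fst z)) * croot z ^ k))"
proof -
  have "real_polynomial_function (\<lambda>z. Re (complex_of_real (pk k (fst z))))"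
    "real_polynomial_function (\<lambda>z. Im (complex_of_real (pk k (fst z))))"
    using real_polynomial_compose_fst[OF coefficient[OF assms]]
    by (simp_all add: real_polynomial_function.intros(2))
  note c = this
    and p = conjunct1[OF real_polynomial_Re_Im_power[OF real_polynomial_croot, of k]]
      conjunct2[OF real_polynomial_Re_Im_power[OF real_polynomial_croot, of k]]
  show "real_polynomial_function (\<lambda>z. Re (complex_of_real (pk k (fst z)) * croot z ^ k))"
    "real_polynomial_function (\<lambda>z. Im (complex_of_real (pk k (fst z)) * croot z ^ k))"
    by (rule real_polynomial_Re_Im_mult[OF c p])+
qed

lemma real_polynomial_pc: "real_polynomial_function PR" "real_polynomial_function PI"
  unfolding pc_def using real_polynomial_term
  by (intro real_polynomial_Re_Im_sum; simp)+

lemma real_polynomial_tail: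
  assumes "j \<le> m"
  shows "real_polynomial_function (\<lambda>z. Re (tail j z))" "real_polynomial_function (\<lambda>z. Im (tail j z))"
  unfolding tail_def using real_polynomial_term assms
  by (intro real_polynomial_Re_Im_sum; simp)+

lemma constraints_eq:
  "constraints pk m = range (\<lambda>j z. 1 - (fst z $ j)\<^sup>2) \<union> {PR, \<lambda>z. - PR z, PI, \<lambda>z. - PI z}"
  unfolding constraints_def pRe_def pIm_def croot_def by simp

lemma real_polynomial_box:
  "real_polynomial_function (\<lambda>z::(real^'n) \<times> real \<times> real. 1 - (fst z $ j)\<^sup>2)"
  by (intro real_polynomial_intros real_polynomial_compose_fst[of "\<lambda>q. q $ j"] real_polynomial_function_vec_nth)

sublocale quadratic_module M
proof (rule quadratic_module_generated)
  fix g assume "g \<in> constraints pk m"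
  then show "real_polynomial_function g"
    unfolding constraints_eq
    using real_polynomial_box real_polynomial_pc real_polynomial_function_minus by blast
qed

lemma constraint_mem: "g \<in> constraints pk m \<Longrightarrow> g \<in> M"
  using generated_module.generator[OF _ real_polynomial_function.intros(2)[of 1]] by simp

lemma constraint_mems:
  "(\<lambda>z. 1 - (fst z $ j)\<^sup>2) \<in> M" "PR \<in> M" "(\<lambda>z. - PR z) \<in> M" "PI \<in> M" "(\<lambda>z. - PI z) \<in> M"
  by (rule constraint_mem; simp add: constraints_eq)+

lemma bounded_coefficient:
  assumes "k \<le> m" shows "bounded_elem (\<lambda>z. pk k (fst z))"
proof (rule bounded_elem_compose[OF coefficient[OF assms]])
  fix b :: "real^'n" assume "b \<in> Basis"
  then obtain i where "b = axis i 1" by (auto simp: Basis_vec_def)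
  then have "(\<lambda>z. fst z \<bullet> b) = (\<lambda>z::(real^'n) \<times> real \<times> real. fst z $ i)" by (auto simp: inner_axis)
  then show "bounded_elem (\<lambda>z. fst z \<bullet> b)"
    using bounded_elem_if_square_le[OF real_polynomial_compose_fst[OF real_polynomial_function_vec_nth]
        constraint_mems(1)[of i]]
    by simp
qed

definition t :: "(real^'n) \<times> real \<times> real \<Rightarrow> real" where
  "t z = (cmod (croot z))\<^sup>2"

lemma cmod_square_mem:
  assumes "real_polynomial_function (\<lambda>z. Re (f z))" "real_polynomial_function (\<lambda>z. Im (f z))"
  shows "(\<lambda>z. (cmod (f z))\<^sup>2) \<in> M"
  unfolding cmod_power2 by (intro add_mem square_mem assms)

lemma t_mult_mem: "f \<in> M \<Longrightarrow> (\<lambda>z. t z * f z) \<in> M"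
  unfolding t_def cmod_power2 distrib_right
  by (intro add_mem square_mult_mem real_polynomial_croot)

lemma t_power_mult_mem: "f \<in> M \<Longrightarrow> (\<lambda>z. t z ^ k * f z) \<in> M"
proof (induction k)
  case (Suc k)
  then show ?case using t_mult_mem[OF Suc.IH] by (simp add: mult.assoc)
qed simp

lemma t_power_mem: "(\<lambda>z. t z ^ k) \<in> M"
  using t_power_mult_mem[OF one_mem] by simp

lemma real_polynomial_t: "real_polynomial_function t"
  using real_polynomial[OF t_power_mem[of 1]] by simp

text \<open>Adding one term w is controlled by the parallelogram law: 2|u|^2 + 2|w|^2 - |u + w|^2 =
  |u - w|^2 is a sum of squares. The coefficient in w is bounded because q is, so |w|^2 is at most B
  t^j modulo M.\<close>

lemma tail_bound:
  assumes "j \<le> m"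
  shows "\<exists>C\<ge>0. (\<lambda>z. C * (\<Sum>k<j. t z ^ k) - (cmod (tail j z))\<^sup>2) \<in> M"
  using assms
proof (induction j)
  case 0
  then show ?case using const_mem[of 0] by (auto simp: tail_def)
next
  case (Suc j)
  then obtain C where C: "C \<ge> 0" "(\<lambda>z. C * (\<Sum>k<j. t z ^ k) - (cmod (tail j z))\<^sup>2) \<in> M" by auto
  obtain B where B: "B > 0" "(\<lambda>z. B - (pk j (fst z))\<^sup>2) \<in> M"
    using bounded_elem_square[OF bounded_coefficient[of j]] Suc.prems unfolding bounded_elem_def by auto
  define w where "w z = complex_of_real (pk j (fst z)) * croot z ^ j" for z
  have w: "real_polynomial_function (\<lambda>z. Re (w z))" "real_polynomial_function (\<lambda>z. Im (w z))"
    using real_polynomial_term[of j] Suc.prems unfolding w_def by auto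
  have "real_polynomial_function (\<lambda>z. Re (tail j z - w z))" "real_polynomial_function (\<lambda>z. Im (tail j z - w z))"
    unfolding minus_complex.sel using Suc.prems by (intro real_polynomial_intros real_polynomial_tail w; simp)+
  from cmod_square_mem[OF this]
  \<comment> \<open>The summands with 2B and 2C only pad all powers up to t^j to the common constant
    2C + 2B.\<close>
  have "(\<lambda>z. 2 * (C * (\<Sum>k<j. t z ^ k) - (cmod (tail j z))\<^sup>2)
      + 2 * B * (\<Sum>k<j. t z ^ k) + 2 * C * t z ^ j + 2 * (t z ^ j * (B - (pk j (fst z))\<^sup>2))
      + (cmod (tail j z - w z))\<^sup>2) \<in> M"
    by (intro add_mem[OF add_mem[OF add_mem[OF add_mem]]] scale_mem[OF _ C(2)]
        scale_mem[OF _ sum_mem[OF _ t_power_mem]] scale_mem[OF _ t_power_mem]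
        scale_mem[OF _ t_power_mult_mem[OF B(2)]]) (use B C in simp_all)
  then have "(\<lambda>z. (2 * C + 2 * B) * (\<Sum>k<Suc j. t z ^ k) - (cmod (tail (Suc j) z))\<^sup>2) \<in> M"
  proof (rule cong_mem)
    fix z
    have parallelogram: "(cmod (u + v))\<^sup>2 = 2 * (cmod u)\<^sup>2 + 2 * (cmod v)\<^sup>2 - (cmod (u - v))\<^sup>2" for u v
      unfolding cmod_power2 by (simp add: power2_eq_square algebra_simps)
    have "(cmod (w z))\<^sup>2 = (pk j (fst z))\<^sup>2 * t z ^ j"
      unfolding w_def t_def
      by (simp add: norm_mult norm_power power_mult_distrib flip: power_mult) (simp add: mult.commute)
    moreover have "tail (Suc j) z = tail j z + w z" unfolding tail_def w_def by simp
    ultimately show "(2 * C + 2 * B) * (\<Sum>k<Suc j. t z ^ k) - (cmod (tail (Suc j) z))\<^sup>2 =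
      2 * (C * (\<Sum>k<j. t z ^ k) - (cmod (tail j z))\<^sup>2)
      + 2 * B * (\<Sum>k<j. t z ^ k) + 2 * C * t z ^ j + 2 * (t z ^ j * (B - (pk j (fst z))\<^sup>2))
      + (cmod (tail j z - w z))\<^sup>2"
      using parallelogram[of "tail j z" "w z"] by (simp add: algebra_simps)
  qed
  then show ?case using B C by (intro exI[of _ "2 * C + 2 * B"]) auto
qed

text \<open>On the variety the leading power equals minus the tail of the polynomial.\<close>

lemma t_power_m_bound:
  obtains C where "C > 0" "(\<lambda>z. C * (\<Sum>k<m. t z ^ k) - t z ^ m) \<in> M"
proof -
  obtain C where C: "C \<ge> 0" "(\<lambda>z. C * (\<Sum>k<m. t z ^ k) - (cmod (tail m z))\<^sup>2) \<in> M"
    using tail_bound[of m] by auto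
  \<comment> \<open>With T the tail, s^m = p - T, so t^m = |p - T|^2 differs from |T|^2 by these
    multiples of \<open>PR\<close> and \<open>PI\<close>, which lie in the support.\<close>
  have "real_polynomial_function (\<lambda>z. 2 * Re (tail m z) - PR z)"
    "real_polynomial_function (\<lambda>z. 2 * Im (tail m z) - PI z)"
    by (intro real_polynomial_intros real_polynomial_tail real_polynomial_pc order_refl)+
  then have "(\<lambda>z. (2 * Re (tail m z) - PR z) * PR z) \<in> M" "(\<lambda>z. (2 * Im (tail m z) - PI z) * PI z) \<in> M"
    using support_mult constraint_mems by auto
  from add_mem[OF add_mem[OF add_mem[OF C(2) this(1)] this(2)] sum_mem[of "{..<m}", OF _ t_power_mem]]
  have "(\<lambda>z. (C + 1) * (\<Sum>k<m. t z ^ k) - t z ^ m) \<in> M"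
  proof (rule cong_mem)
    fix z
    have "pc pk m (fst z) (croot z) = tail m z + croot z ^ m"
      unfolding pc_def tail_def lessThan_Suc_atMost[symmetric] by (simp add: monic)
    then have s: "croot z ^ m = pc pk m (fst z) (croot z) - tail m z" by simp
    have "t z ^ m = (cmod (croot z ^ m))\<^sup>2"
      unfolding t_def by (simp add: norm_power flip: power_mult) (simp add: mult.commute)
    then have "t z ^ m = (cmod (tail m z))\<^sup>2 - (2 * Re (tail m z) - PR z) * PR z - (2 * Im (tail m z) - PI z) * PI z"
      unfolding s cmod_power2 by (simp add: power2_eq_square algebra_simps)
    then show "(C + 1) * (\<Sum>k<m. t z ^ k) - t z ^ m =
       C * (\<Sum>k<m. t z ^ k) - (cmod (tail m z))\<^sup>2 + (2 * Re (tail m z) - PR z) * PR z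
       + (2 * Im (tail m z) - PI z) * PI z + (\<Sum>k<m. t z ^ k)"
      by (simp add: algebra_simps)
  qed simp
  then show thesis using that[of "C + 1"] C by simp
qed

text \<open>A weighted arithmetic-geometric inequality: t^j (\<delta> t - 1)^2 / \<delta> bounds
  twice t^(j+1) by \<delta> t^(j+2) + t^j / \<delta>. The induction hypothesis, divided by \<delta>,
  replaces the last term by t^(j+1) plus a constant.\<close>

lemma t_power_step:
  "\<delta> > 0 \<Longrightarrow> \<exists>C\<ge>0. (\<lambda>z. \<delta> * t z ^ Suc j + C - t z ^ j) \<in> M"
proof (induction j)
  case 0
  have "(\<lambda>z. \<delta> * t z ^ 1) \<in> M" using 0 by (intro scale_mem t_power_mem) auto
  then show ?case by (intro exI[of _ 1]) simp
next
  case (Suc j)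
  then obtain C where C: "C \<ge> 0" "(\<lambda>z. \<delta> * t z ^ Suc j + C - t z ^ j) \<in> M" by blast
  have "real_polynomial_function (\<lambda>z. \<delta> * t z - 1)"
    by (intro real_polynomial_intros real_polynomial_t)
  from t_power_mult_mem[OF square_mem[OF this], of j]
  have "(\<lambda>z. 1 / \<delta> * (t z ^ j * (\<delta> * t z - 1)\<^sup>2 + (\<delta> * t z ^ Suc j + C - t z ^ j))) \<in> M"
    using Suc.prems by (intro scale_mem add_mem[OF _ C(2)]) simp_all
  then have "(\<lambda>z. \<delta> * t z ^ Suc (Suc j) + C / \<delta> - t z ^ Suc j) \<in> M"
    by (rule cong_mem) (use Suc.prems in \<open>simp add: field_simps power2_eq_square\<close>)
  then show ?case using C Suc.prems by (intro exI[of _ "C / \<delta>"]) auto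
qed

lemma t_power_le:
  assumes "\<delta> > 0"
  shows "\<exists>C\<ge>0. (\<lambda>z. \<delta> * t z ^ (j + Suc l) + C - t z ^ j) \<in> M"
proof (induction l)
  case 0
  then show ?case using t_power_step[OF assms, of j] by simp
next
  case (Suc l)
  then obtain C where C: "C \<ge> 0" "(\<lambda>z. \<delta> * t z ^ (j + Suc l) + C - t z ^ j) \<in> M" by blast
  obtain D where D: "D \<ge> 0" "(\<lambda>z. 1 * t z ^ Suc (j + Suc l) + D - t z ^ (j + Suc l)) \<in> M"
    using t_power_step[of 1 "j + Suc l"] by auto
  from add_mem[OF C(2) scale_mem[OF less_imp_le[OF assms] D(2)]]
  have "(\<lambda>z. \<delta> * t z ^ (j + Suc (Suc l)) + (C + \<delta> * D) - t z ^ j) \<in> M"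
    by (rule cong_mem) (simp add: algebra_simps)
  then show ?case using C D assms by (intro exI[of _ "C + \<delta> * D"]) auto
qed

text \<open>All lower powers of t are absorbed into half of t^m, leaving a constant bound on the
  other half.\<close>

lemma t_bound: "\<exists>N. (\<lambda>z. N - t z) \<in> M"
proof -
  obtain C where C: "C > 0" "(\<lambda>z. C * (\<Sum>k<m. t z ^ k) - t z ^ m) \<in> M"
    using t_power_m_bound by blast
  \<comment> \<open>The m lower powers, each weighted by C, contribute C m \<delta> = 1/2 to the
    coefficient of t^m.\<close>
  define \<delta> where "\<delta> = 1 / (2 * C * m)"
  have \<delta>: "\<delta> > 0" "C * (real m * \<delta>) = 1 / 2" unfolding \<delta>_def using C m_pos by (simp_all add: field_simps)
  have "\<forall>k. \<exists>c. k < m \<longrightarrow> (\<lambda>z. \<delta> * t z ^ m + c - t z ^ k) \<in> M"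
  proof (intro allI)
    fix k
    show "\<exists>c. k < m \<longrightarrow> (\<lambda>z. \<delta> * t z ^ m + c - t z ^ k) \<in> M"
    proof (cases "k < m")
      case True
      then have m: "k + Suc (m - Suc k) = m" by simp
      show ?thesis using t_power_le[OF \<delta>(1), of k "m - Suc k"] unfolding m by blast
    qed auto
  qed
  from choice[OF this] obtain c where c: "\<And>k. k < m \<Longrightarrow> (\<lambda>z. \<delta> * t z ^ m + c k - t z ^ k) \<in> M"
    by blast
  have "(\<lambda>z. \<Sum>k<m. \<delta> * t z ^ m + c k - t z ^ k) \<in> M" by (intro sum_mem) (auto intro: c)
  from add_mem[OF C(2) scale_mem[OF less_imp_le[OF C(1)] this]]
  have "(\<lambda>z. C * (\<Sum>k<m. c k) - 1 / 2 * t z ^ m) \<in> M"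
  proof (rule cong_mem)
    fix z
    have "C * (\<Sum>k<m. \<delta> * t z ^ m + c k - t z ^ k)
        = C * (real m * \<delta>) * t z ^ m + C * (\<Sum>k<m. c k) - C * (\<Sum>k<m. t z ^ k)"
      by (simp add: sum.distrib sum_subtractf algebra_simps)
    then show "C * (\<Sum>k<m. c k) - 1 / 2 * t z ^ m =
        C * (\<Sum>k<m. t z ^ k) - t z ^ m + C * (\<Sum>k<m. \<delta> * t z ^ m + c k - t z ^ k)"
      unfolding \<delta>(2) by simp
  qed
  from scale_mem[OF _ this, of 2]
  have tm: "(\<lambda>z. 2 * (C * (\<Sum>k<m. c k)) - t z ^ m) \<in> M"
    by (simp add: algebra_simps)
  show ?thesis
  proof (cases "m = 1")
    case True
    then show ?thesis using tm by auto
  next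
    case False
    then have "1 + Suc (m - 2) = m" using m_pos by simp
    then obtain D where "(\<lambda>z. 1 * t z ^ m + D - t z ^ 1) \<in> M"
      using t_power_le[of 1 1 "m - 2"] by auto
    from add_mem[OF tm this]
    have "(\<lambda>z. (2 * (C * (\<Sum>k<m. c k)) + D) - t z) \<in> M" by (rule cong_mem) simp
    then show ?thesis by blast
  qed
qed

text \<open>With t = x^2 + y^2, adding y^2 to N - t bounds x^2, and symmetrically for y. The box
  constraints bound q.\<close>

lemma archimedean:
  assumes "real_polynomial_function f" shows "bounded_elem f"
proof -
  obtain N where N: "(\<lambda>z. N - t z) \<in> M" using t_bound by blast
  have re: "bounded_elem (\<lambda>z. Re (croot z))"
    by (rule bounded_elem_if_square_le[OF real_polynomial_croot(1), of N],
        rule cong_mem[OF add_mem[OF N square_mem[OF real_polynomial_croot(2)]]])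
       (simp add: t_def cmod_power2)
  have im: "bounded_elem (\<lambda>z. Im (croot z))"
    by (rule bounded_elem_if_square_le[OF real_polynomial_croot(2), of N],
        rule cong_mem[OF add_mem[OF N square_mem[OF real_polynomial_croot(1)]]])
       (simp add: t_def cmod_power2)
  have q: "bounded_elem (\<lambda>z. fst z $ i)" for i
    by (rule bounded_elem_if_square_le[OF real_polynomial_compose_fst[OF real_polynomial_function_vec_nth]
        constraint_mems(1)])
  show ?thesis
  proof (rule bounded_elem_compose[OF assms])
    fix b :: "(real^'n) \<times> real \<times> real" assume "b \<in> Basis"
    then show "bounded_elem (\<lambda>z. z \<bullet> b)"
      by (cases rule: Basis_qxy_cases) (use re im q in \<open>simp_all add: croot_def\<close>)
  qed
qed

text \<open>A point where M is nonnegative is a pair of some q in the cube and a root s of p(q, .),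
  so the hypothesis is the positivity that \<open>putinar\<close> requires of v(q) - x.\<close>

lemma positive_imp_feasible:
  assumes v: "real_polynomial_function v"
    and pos: "\<And>q s. q \<in> cubeQ \<Longrightarrow> pc pk m q s = 0 \<Longrightarrow> Re s < v q"
  shows "\<exists>D. \<forall>d\<ge>D. feasible pk m d v"
proof -
  have "(\<lambda>z. v (fst z) - Re (croot z)) \<in> M"
  proof (rule putinar[OF archimedean])
    show "real_polynomial_function (\<lambda>z::(real^'n) \<times> real \<times> real. v (fst z) - Re (croot z))"
      by (intro real_polynomial_intros real_polynomial_compose_fst v real_polynomial_croot)
    fix w assume w: "\<And>g. g \<in> M \<Longrightarrow> 0 \<le> g w"
    have "(fst w $ j)\<^sup>2 \<le> 1" for j using w[OF constraint_mems(1)[of j]] by simp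
    then have "fst w \<in> cubeQ"
      unfolding cubeQ_def by (auto simp: mem_box_cart abs_square_le_1 abs_le_iff minus_le_iff)
    moreover have "pc pk m (fst w) (croot w) = 0"
      using w[OF constraint_mems(2)] w[OF constraint_mems(3)] w[OF constraint_mems(4)] w[OF constraint_mems(5)]
      by (simp add: complex_eq_iff)
    ultimately show "0 < v (fst w) - Re (croot w)" using pos by fastforce
  qed
  then obtain D where D: "\<forall>d\<ge>D. certificate pk m d (\<lambda>z. v (fst z) - fst (snd z))"
    using certificate_exists unfolding croot_def complex.sel by blast
  obtain k where "poly_q k v" using real_polynomial_poly_q[OF v] by blast
  then have "poly_q (2 * int d) v" if "d \<ge> nat k" for d
    using that unfolding poly_q_expansion by (elim q.expansion_mono) auto
  then show ?thesis
    using D by (intro exI[of _ "max D (nat k)"]) (auto simp: feasible_iff_certificate)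
qed

end

section \<open>Continuity of the abscissa\<close>

context monic_family
begin

lemma pc_factorization: "\<exists>r. \<forall>s. pc pk m q s = (\<Prod>i<m. s - r i)"
proof -
  define P where "P = (\<Sum>k\<le>m. monom (complex_of_real (pk k q)) k)"
  have coeff: "coeff P i = (if i \<le> m then complex_of_real (pk i q) else 0)" for i
    unfolding P_def coeff_sum coeff_monom by (simp add: sum.delta)
  have "degree P \<le> m" by (rule degree_le) (simp add: coeff)
  moreover have "m \<le> degree P" by (rule le_degree) (simp add: coeff monic)
  ultimately have deg: "degree P = m" by simp
  then have lead: "lead_coeff P = 1" by (simp add: coeff monic)
  obtain r where "smult (lead_coeff P) (\<Prod>i<degree P. [:- r i, 1:]) = P"
    by (rule complex_poly_decompose')
  then have P: "P = (\<Prod>i<m. [:- r i, 1:])" using lead deg by simp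
  have "pc pk m q s = poly P s" for s
    unfolding pc_def P_def by (simp add: poly_sum poly_monom)
  also have "poly P s = (\<Prod>i<m. s - r i)" for s
    unfolding P by (simp add: poly_prod)
  finally show ?thesis by blast
qed

text \<open>|p(q, s)| is the product of the distances from s to the m roots, hence at least the m-th
  power of the least distance.\<close>

lemma nearby_root:
  obtains r where "pc pk m q r = 0" "cmod (s - r) ^ m \<le> cmod (pc pk m q s)"
proof -
  obtain r where r: "\<And>s. pc pk m q s = (\<Prod>i<m. s - r i)" using pc_factorization[of q] by blast
  have ne: "{..<m} \<noteq> {}" using m_pos by (auto simp: lessThan_empty_iff)
  obtain i where i: "i < m" "\<And>j. j < m \<Longrightarrow> cmod (s - r i) \<le> cmod (s - r j)"
    using arg_min_if_finite[OF finite_lessThan ne, of "\<lambda>j. cmod (s - r j)"]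
    by (metis lessThan_iff linorder_not_le)
  have "cmod (s - r i) ^ m = (\<Prod>j<m. cmod (s - r i))" by simp
  also have "\<dots> \<le> (\<Prod>j<m. cmod (s - r j))" using i(2) by (intro prod_mono) auto
  also have "\<dots> = cmod (pc pk m q s)" unfolding r by (rule prod_norm)
  finally have "cmod (s - r i) ^ m \<le> cmod (pc pk m q s)" .
  moreover have "pc pk m q (r i) = 0" unfolding r using i(1) by (intro prod_zero) auto
  ultimately show thesis using that by blast
qed

text \<open>Needed for \<open>Max\<close> in \<open>abscissa\<close> to be a genuine maximum; a root
  exists by \<open>nearby_root\<close>.\<close>

lemma finite_roots: "finite {s. pc pk m q s = 0}"
proof -
  obtain r where r: "\<And>s. pc pk m q s = (\<Prod>i<m. s - r i)" using pc_factorization[of q] by blast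
  have "{s. pc pk m q s = 0} \<subseteq> r ` {..<m}" unfolding r by auto
  then show ?thesis using finite_surj by blast
qed

lemma Re_root_le_abscissa: "pc pk m q s = 0 \<Longrightarrow> Re s \<le> abscissa pk m q"
  unfolding abscissa_def using finite_roots by (intro Max_ge) auto

lemma abscissa_attained: obtains s where "pc pk m q s = 0" "Re s = abscissa pk m q"
proof -
  obtain r where "pc pk m q r = 0" using nearby_root by blast
  then have "abscissa pk m q \<in> Re ` {s. pc pk m q s = 0}"
    unfolding abscissa_def using finite_roots by (intro Max_in) auto
  then show thesis using that by auto
qed

text \<open>Cauchy's bound: if |s| > 1, divide the root equation by |s|^(m-1).\<close>

lemma root_bound:
  assumes "pc pk m q s = 0" shows "cmod s \<le> 1 + (\<Sum>k<m. \<bar>pk k q\<bar>)"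
proof (cases "cmod s \<le> 1")
  case True
  have "0 \<le> (\<Sum>k<m. \<bar>pk k q\<bar>)" by (intro sum_nonneg) auto
  then show ?thesis using True by linarith
next
  case False
  have "0 = (\<Sum>k<m. complex_of_real (pk k q) * s ^ k) + s ^ m"
    using assms unfolding pc_def lessThan_Suc_atMost[symmetric] by (simp add: monic)
  then have "s ^ m = - (\<Sum>k<m. complex_of_real (pk k q) * s ^ k)"
    by (simp add: eq_neg_iff_add_eq_0 add.commute)
  then have "cmod s ^ m = cmod (\<Sum>k<m. complex_of_real (pk k q) * s ^ k)"
    by (metis norm_minus_cancel norm_power)
  also have "\<dots> \<le> (\<Sum>k<m. cmod (complex_of_real (pk k q) * s ^ k))" by (rule norm_sum)
  also have "\<dots> \<le> (\<Sum>k<m. \<bar>pk k q\<bar> * cmod s ^ (m - 1))"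
    using False by (intro sum_mono) (auto simp: norm_mult norm_power intro!: mult_left_mono power_increasing)
  finally have "cmod s * cmod s ^ (m - 1) \<le> (\<Sum>k<m. \<bar>pk k q\<bar>) * cmod s ^ (m - 1)"
    using m_pos by (simp add: sum_distrib_right power_eq_if)
  moreover have "cmod s ^ (m - 1) > 0" using False by (intro zero_less_power) linarith
  ultimately have "cmod s \<le> (\<Sum>k<m. \<bar>pk k q\<bar>)" by simp
  then show ?thesis by linarith
qed

text \<open>A root s for q attaining the abscissa almost solves the equation for q', since |p(q',
  s)| = |p(q', s) - p(q, s)| is at most e^m. A root for q' is therefore within e of s.\<close>

lemma abscissa_diff_le:
  assumes R: "\<And>s. pc pk m q s = 0 \<Longrightarrow> cmod s \<le> R"
    and e: "0 \<le> e" "(\<Sum>k\<le>m. \<bar>pk k q - pk k q'\<bar> * R ^ k) \<le> e ^ m"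
  shows "abscissa pk m q - abscissa pk m q' \<le> e"
proof -
  obtain s where s: "pc pk m q s = 0" "Re s = abscissa pk m q" by (rule abscissa_attained)
  obtain r where r: "pc pk m q' r = 0" "cmod (s - r) ^ m \<le> cmod (pc pk m q' s)" by (rule nearby_root)
  have "cmod (pc pk m q' s) = cmod (pc pk m q s - pc pk m q' s)" using s by simp
  also have "\<dots> = cmod (\<Sum>k\<le>m. complex_of_real (pk k q - pk k q') * s ^ k)"
    unfolding pc_def sum_subtractf[symmetric] by (simp add: algebra_simps)
  also have "\<dots> \<le> (\<Sum>k\<le>m. cmod (complex_of_real (pk k q - pk k q') * s ^ k))" by (rule norm_sum)
  also have "\<dots> \<le> (\<Sum>k\<le>m. \<bar>pk k q - pk k q'\<bar> * R ^ k)"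
    unfolding norm_mult norm_power norm_of_real
    by (intro sum_mono mult_left_mono power_mono R s(1)) auto
  finally have "cmod (s - r) ^ m \<le> e ^ m" using r(2) e(2) by linarith
  then have "cmod (s - r) \<le> e" using e(1) m_pos by (simp add: power_mono_iff)
  then have "Re s - Re r \<le> e" using complex_Re_le_cmod[of "s - r"] by simp
  then show ?thesis using Re_root_le_abscissa[OF r(1)] s(2) by linarith
qed

lemma continuous_coefficient: "k \<le> m \<Longrightarrow> continuous_on S (pk k)"
  using continuous_on_polymonial_function coefficient real_polynomial_function_eq by blast

text \<open>By compactness one R bounds the roots over the whole cube, so
  \<open>abscissa_diff_le\<close> applies in both directions.\<close>

lemma continuous_on_abscissa: "continuous_on cubeQ (abscissa pk m)"
proof -
  have "compact ((\<lambda>q. 1 + (\<Sum>k<m. \<bar>pk k q\<bar>)) ` cubeQ)"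
    unfolding cubeQ_def
    by (intro compact_continuous_image compact_cbox continuous_intros continuous_coefficient) auto
  then obtain R where R: "\<And>q. q \<in> cubeQ \<Longrightarrow> 1 + (\<Sum>k<m. \<bar>pk k q\<bar>) \<le> R"
    by (meson bounded_imp_bdd_above bdd_above.unfold compact_imp_bounded imageI)
  have bound: "cmod s \<le> R" if "q \<in> cubeQ" "pc pk m q s = 0" for q s
    using root_bound[OF that(2)] R[OF that(1)] by linarith
  show ?thesis
    unfolding continuous_on_def
  proof (intro ballI tendstoI)
    fix q0 :: "real^'n" and e :: real assume q0: "q0 \<in> cubeQ" and e: "e > 0"
    have "((\<lambda>q. \<Sum>k\<le>m. \<bar>pk k q - pk k q0\<bar> * R ^ k) \<longlongrightarrow> (\<Sum>k\<le>m. \<bar>pk k q0 - pk k q0\<bar> * R ^ k)) (at q0 within cubeQ)"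
      using continuous_coefficient q0 unfolding continuous_on_def by (intro tendsto_intros) auto
    then have "((\<lambda>q. \<Sum>k\<le>m. \<bar>pk k q - pk k q0\<bar> * R ^ k) \<longlongrightarrow> 0) (at q0 within cubeQ)" by simp
    then have "\<forall>\<^sub>F q in at q0 within cubeQ. (\<Sum>k\<le>m. \<bar>pk k q - pk k q0\<bar> * R ^ k) < (e / 2) ^ m"
      using e by (intro order_tendstoD(2)) auto
    moreover have "\<forall>\<^sub>F q in at q0 within cubeQ. q \<in> cubeQ" by (simp add: eventually_at_filter)
    ultimately show "\<forall>\<^sub>F q in at q0 within cubeQ. dist (abscissa pk m q) (abscissa pk m q0) < e"
    proof eventually_elim
      case (elim q)
      have "abscissa pk m q - abscissa pk m q0 \<le> e / 2"
        using elim e bound by (intro abscissa_diff_le[of _ R]) auto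
      moreover have "abscissa pk m q0 - abscissa pk m q \<le> e / 2"
        using elim e bound q0 by (intro abscissa_diff_le[of _ R]) (auto simp: abs_minus_commute)
      ultimately show ?case using e by (simp add: dist_real_def)
    qed
  qed
qed

section \<open>Bounds and limit for the value of the program\<close>

text \<open>The identity is evaluated at (q, Re s, Im s) for a root s of largest real part: the
  ideal terms vanish and the others are nonnegative.\<close>

lemma feasible_ge_abscissa:
  assumes "feasible pk m d v" "q \<in> cubeQ" shows "abscissa pk m q \<le> v q"
proof -
  obtain s where s: "pc pk m q s = 0" "Re s = abscissa pk m q" by (rule abscissa_attained)
  obtain \<sigma>0 \<sigma> \<tau>R \<tau>I where \<sigma>: "sos_qxy (2 * int d) \<sigma>0" "\<forall>j. sos_qxy (2 * int d - 2) (\<sigma> j)"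
    and eq: "\<forall>q x y. v q - x = \<sigma>0 q x y + (\<Sum>j\<in>UNIV. \<sigma> j q x y * (1 - (q $ j)\<^sup>2))
                    + \<tau>R q x y * pRe pk m q x y + \<tau>I q x y * pIm pk m q x y"
    using assms(1) unfolding feasible_def by blast
  have "\<bar>q $ j\<bar> \<le> 1" for j
    using assms(2) unfolding cubeQ_def by (auto simp: mem_box_cart abs_le_iff minus_le_iff)
  then have "0 \<le> (\<Sum>j\<in>UNIV. \<sigma> j q (Re s) (Im s) * (1 - (q $ j)\<^sup>2))"
    using \<sigma>(2) by (intro sum_nonneg mult_nonneg_nonneg) (auto simp: abs_square_le_1 intro: sos_qxy_nonneg)
  moreover have "pRe pk m q (Re s) (Im s) = 0" "pIm pk m q (Re s) (Im s) = 0"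
    using s(1) by (simp_all add: pRe_def pIm_def)
  moreover have "0 \<le> \<sigma>0 q (Re s) (Im s)" using \<sigma>(1) by (rule sos_qxy_nonneg)
  ultimately have "0 \<le> v q - Re s" using eq[rule_format, of q "Re s" "Im s"] by simp
  then show ?thesis using s(2) by simp
qed

lemma feasible_integrable:
  assumes "feasible pk m d v" shows "v integrable_on cubeQ"
proof -
  have "real_polynomial_function v" using assms poly_q_real_polynomial unfolding feasible_def by blast
  then show ?thesis
    unfolding cubeQ_def
    by (intro integrable_continuous continuous_on_polymonial_function)
       (simp add: real_polynomial_function_eq)
qed

lemma abscissa_integrable: "abscissa pk m integrable_on cubeQ"
  using integrable_continuous continuous_on_abscissa unfolding cubeQ_def by blast

text \<open>Also true for d without feasible points, where the infimum in \<open>ereal\<close> is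
  infinite.\<close>

lemma integral_abscissa_le_rho: "ereal (integral cubeQ (abscissa pk m)) \<le> rho pk m d"
  unfolding rho_def
  using feasible_ge_abscissa feasible_integrable abscissa_integrable
  by (auto intro!: Inf_greatest integral_le)

lemma eventually_rho_le:
  assumes "e > 0"
  shows "\<forall>\<^sub>F d in sequentially. rho pk m d \<le> ereal (integral cubeQ (abscissa pk m) + e)"
proof -
  define V where "V = measure lborel (cubeQ :: (real^'n) set)"
  have "V \<ge> 0" unfolding V_def by simp
  \<comment> \<open>The approximant g of a + \<epsilon> lies strictly between a and a + 2\<epsilon>,
    so its integral exceeds that of a by at most 2\<epsilon>V. The divisor V + 1 is visibly
    positive.\<close>
  define \<epsilon> where "\<epsilon> = e / (2 * (V + 1))"
  have \<epsilon>: "\<epsilon> > 0" "2 * \<epsilon> * V \<le> e"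
    unfolding \<epsilon>_def using assms \<open>V \<ge> 0\<close> by (auto simp: field_simps)
  have "compact (cubeQ :: (real^'n) set)" unfolding cubeQ_def by (rule compact_cbox)
  moreover have "continuous_on cubeQ (\<lambda>q. abscissa pk m q + \<epsilon>)"
    by (intro continuous_intros continuous_on_abscissa)
  ultimately obtain g where g: "real_polynomial_function g"
    "\<And>q. q \<in> cubeQ \<Longrightarrow> \<bar>abscissa pk m q + \<epsilon> - g q\<bar> < \<epsilon>"
    using Stone_Weierstrass_real_polynomial_function[OF _ _ \<epsilon>(1)] by blast
  have "\<exists>D. \<forall>d\<ge>D. feasible pk m d g"
  proof (rule positive_imp_feasible[OF g(1)])
    fix q s assume "q \<in> cubeQ" "pc pk m q s = 0"
    then show "Re s < g q" using g(2)[of q] Re_root_le_abscissa[of q s] by linarith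
  qed
  then obtain D where D: "\<And>d. d \<ge> D \<Longrightarrow> feasible pk m d g" by blast
  have "integral cubeQ g \<le> integral cubeQ (\<lambda>q. abscissa pk m q + 2 * \<epsilon>)"
  proof (rule integral_le)
    show "g integrable_on cubeQ" using feasible_integrable D by blast
    show "(\<lambda>q. abscissa pk m q + 2 * \<epsilon>) integrable_on cubeQ"
      using abscissa_integrable by (intro integrable_add) (auto simp: cubeQ_def)
    show "g q \<le> abscissa pk m q + 2 * \<epsilon>" if "q \<in> cubeQ" for q
      using g(2)[OF that] by linarith
  qed
  also have "\<dots> = integral cubeQ (abscissa pk m) + integral cubeQ (\<lambda>q::real^'n. 2 * \<epsilon>)"
    using abscissa_integrable by (intro integral_add) (auto simp: cubeQ_def)
  also have "integral cubeQ (\<lambda>q::real^'n. 2 * \<epsilon>) = 2 * \<epsilon> * V"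
    unfolding V_def cubeQ_def by simp
  finally have "integral cubeQ g \<le> integral cubeQ (abscissa pk m) + e" using \<epsilon>(2) by linarith
  moreover have "rho pk m d \<le> ereal (integral cubeQ g)" if "d \<ge> D" for d
    unfolding rho_def using D[OF that] by (intro Inf_lower) auto
  ultimately show ?thesis
    unfolding eventually_sequentially by (meson ereal_less_eq(3) order_trans)
qed

lemma rho_tendsto: "(\<lambda>d. rho pk m d) \<longlonglongrightarrow> ereal (integral cubeQ (abscissa pk m))"
proof (rule order_tendstoI)
  fix a assume "a < ereal (integral cubeQ (abscissa pk m))"
  then show "\<forall>\<^sub>F d in sequentially. a < rho pk m d"
    using integral_abscissa_le_rho by (intro always_eventually) (meson less_le_trans)
next
  fix a assume "ereal (integral cubeQ (abscissa pk m)) < a"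
  \<comment> \<open>The upper bound may be infinite; a real b below it supplies a real gap.\<close>
  then obtain b where b: "ereal (integral cubeQ (abscissa pk m)) < ereal b" "ereal b < a"
    using ereal_dense2 by blast
  then have "b - integral cubeQ (abscissa pk m) > 0" by simp
  from eventually_rho_le[OF this] show "\<forall>\<^sub>F d in sequentially. rho pk m d < a"
    by eventually_elim (use b in auto)
qed

end

section \<open>Convergence of near optimal solutions\<close>

theorem theorem1:
  fixes pk :: "nat \<Rightarrow> real^'n::finite \<Rightarrow> real"
    and m d0 :: nat
    and v :: "nat \<Rightarrow> real^'n \<Rightarrow> real"
  assumes "m \<ge> 1"
    and "\<forall>k\<le>m. \<exists>D. poly_q D (pk k)"
    and "\<forall>q. pk m q = 1"
    and "\<forall>d\<ge>d0. \<exists>w. feasible pk m d w"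
    and "\<forall>d\<ge>d0. feasible pk m d (v d) \<and>
           ereal (integral cubeQ (v d)) \<le> rho pk m d + ereal (1 / real d)"
  shows "(\<forall>d\<ge>d0. \<forall>q\<in>cubeQ. abscissa pk m q \<le> v d q)
    \<and> (\<lambda>d. integral cubeQ (\<lambda>q. \<bar>v d q - abscissa pk m q\<bar>)) \<longlonglongrightarrow> 0
    \<and> (\<lambda>d. rho pk m d) \<longlonglongrightarrow> ereal (integral cubeQ (abscissa pk m))"
proof -
  interpret monic_family pk m
    using assms(1-3) poly_q_real_polynomial by unfold_locales blast+
  let ?a = "integral cubeQ (abscissa pk m)"
  have ge: "abscissa pk m q \<le> v d q" if "d \<ge> d0" "q \<in> cubeQ" for d q
    using assms(5) that feasible_ge_abscissa by blast
  \<comment> \<open>Since v_d dominates a, the L1 distance is a difference of integrals, and only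
    convergence of the integrals of v_d remains.\<close>
  have L1: "integral cubeQ (\<lambda>q. \<bar>v d q - abscissa pk m q\<bar>) = integral cubeQ (v d) - ?a" if "d \<ge> d0" for d
  proof -
    have "integral cubeQ (\<lambda>q. \<bar>v d q - abscissa pk m q\<bar>) = integral cubeQ (\<lambda>q. v d q - abscissa pk m q)"
      using ge[OF that] by (intro Henstock_Kurzweil_Integration.integral_cong) auto
    also have "\<dots> = integral cubeQ (v d) - ?a"
      using assms(5) that feasible_integrable abscissa_integrable
      by (intro Henstock_Kurzweil_Integration.integral_diff) auto
    finally show ?thesis .
  qed
  have "(\<lambda>d. integral cubeQ (v d)) \<longlonglongrightarrow> ?a"
  proof (rule order_tendstoI)
    fix c assume "c < ?a"
    moreover have "?a \<le> integral cubeQ (v d)" if "d \<ge> d0" for d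
      using assms(5) that feasible_integrable abscissa_integrable ge by (intro integral_le) auto
    ultimately show "\<forall>\<^sub>F d in sequentially. c < integral cubeQ (v d)"
      unfolding eventually_sequentially by (meson less_le_trans)
  next
    fix c assume c: "?a < c"
    \<comment> \<open>Half of the gap is spent on \<open>rho\<close>, the other half on the slack
      1/d.\<close>
    define e where "e = (c - ?a) / 2"
    have e: "e > 0" "c = ?a + e + e" unfolding e_def using c by (auto simp: field_simps)
    have "\<forall>\<^sub>F d in sequentially. 1 / real d < e"
      using order_tendstoD(2)[OF lim_1_over_n e(1)] .
    with eventually_rho_le[OF e(1)] eventually_ge_at_top[of d0]
    show "\<forall>\<^sub>F d in sequentially. integral cubeQ (v d) < c"
    proof eventually_elim
      case (elim d)
      have "ereal (integral cubeQ (v d)) \<le> rho pk m d + ereal (1 / real d)" using assms(5) elim by blast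
      also have "\<dots> \<le> ereal (?a + e) + ereal (1 / real d)" using elim by (intro add_mono) auto
      finally have "integral cubeQ (v d) \<le> ?a + e + 1 / real d" by simp
      then show ?case using elim e by linarith
    qed
  qed
  then have "(\<lambda>d. integral cubeQ (v d) - ?a) \<longlonglongrightarrow> ?a - ?a" by (intro tendsto_intros)
  moreover have "\<forall>\<^sub>F d in sequentially. integral cubeQ (v d) - ?a = integral cubeQ (\<lambda>q. \<bar>v d q - abscissa pk m q\<bar>)"
    using eventually_ge_at_top[of d0] by eventually_elim (simp add: L1)
  ultimately have "(\<lambda>d. integral cubeQ (\<lambda>q. \<bar>v d q - abscissa pk m q\<bar>)) \<longlonglongrightarrow> 0"
    using Lim_transform_eventually by fastforce
  then show ?thesis using ge rho_tendsto by blast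
qed

end
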